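(* Let $(e_i)_{i=1}^\infty$ be a $1$-subsymmetric normalized basis of a Banach space $X$ which is not equivalent to the unit vector basis of $\ell_1$. Suppose that, for each $n\ge1$, there exist unit vectors $z_1<z_2<\cdots<z_n$ in $X$ such that $z_i$ is a right shift of $z_1$ for $1\le i\le n$ and $\left\|\sum_{i=1}^n z_i\right\|\ge\frac n2$. Then $X$ contains a continuum of subsymmetric sequences with (pairwise) non-equivalent fundamental functions.
   Context: A basic sequence is subsymmetric if it is unconditional and equivalent to each of its subsequences (equivalence of basic sequences $(x_j)$, $(y_j)$: $\sum a_jx_j$ converges if and only if $\sum a_jy_j$ converges). It is $1$-subsymmetric if it is $1$-unconditional and isometrically equivalent to each of its subsequences. For vectors $x,y$, $x<y$ means $\max\operatorname{supp}(x)<\min\operatorname{supp}(y)$, supports being taken with respect to $(e_i)$. A right shift of $z=\sum_j a_je_j$ is a vector $\sum_j a_je_{j+m}$ with $m\ge0$. The fundamental function of a subsymmetric sequence $(u_i)$ is $\Phi(n)=\|\sum_{i=1}^nu_i\|$; two fundamental functions $\Phi,\Psi$ are equivalent if there is $K>0$ with $K^{-1}\Phi(n)\le\Psi(n)\le K\Phi(n)$ for all $n\in\mathbb N$. "A continuum" means a family of cardinality $2^{\aleph_0}$. *)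

theory Defs
  imports "HOL-Analysis.Analysis"
begin

section \<open>The space of absolutely summable real sequences\<close>

typedef l1 = "{f :: nat \<Rightarrow> real. summable (\<lambda>k. \<bar>f k\<bar>)}"
  morphisms l1_nth Abs_l1
  by (rule exI[of _ "\<lambda>_. 0"]) simp

setup_lifting type_definition_l1

instantiation l1 :: real_normed_vector
begin

lift_definition zero_l1 :: l1 is "\<lambda>_. 0"
  by simp

lift_definition plus_l1 :: "l1 \<Rightarrow> l1 \<Rightarrow> l1" is "\<lambda>f g k. f k + g k"
proof -
  fix f g :: "nat \<Rightarrow> real"
  assume "summable (\<lambda>k. \<bar>f k\<bar>)" "summable (\<lambda>k. \<bar>g k\<bar>)"
  then have "summable (\<lambda>k. \<bar>f k\<bar> + \<bar>g k\<bar>)"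
    by (rule summable_add)
  then show "summable (\<lambda>k. \<bar>f k + g k\<bar>)"
    by (rule summable_comparison_test'[where N = 0]) auto
qed

lift_definition minus_l1 :: "l1 \<Rightarrow> l1 \<Rightarrow> l1" is "\<lambda>f g k. f k - g k"
proof -
  fix f g :: "nat \<Rightarrow> real"
  assume "summable (\<lambda>k. \<bar>f k\<bar>)" "summable (\<lambda>k. \<bar>g k\<bar>)"
  then have "summable (\<lambda>k. \<bar>f k\<bar> + \<bar>g k\<bar>)"
    by (rule summable_add)
  then show "summable (\<lambda>k. \<bar>f k - g k\<bar>)"
    by (rule summable_comparison_test'[where N = 0]) auto
qed

lift_definition uminus_l1 :: "l1 \<Rightarrow> l1" is "\<lambda>f k. - f k"
  by simp

lift_definition scaleR_l1 :: "real \<Rightarrow> l1 \<Rightarrow> l1" is "\<lambda>c f k. c * f k"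
  by (simp add: abs_mult summable_mult)

lift_definition norm_l1 :: "l1 \<Rightarrow> real" is "\<lambda>f. \<Sum>k. \<bar>f k\<bar>" .

definition dist_l1 :: "l1 \<Rightarrow> l1 \<Rightarrow> real"
  where "dist_l1 x y = norm (x - y)"

definition sgn_l1 :: "l1 \<Rightarrow> l1"
  where "sgn_l1 x = inverse (norm x) *\<^sub>R x"

definition uniformity_l1 :: "(l1 \<times> l1) filter"
  where "uniformity_l1 = (INF e\<in>{0 <..}. principal {(x, y). dist x y < e})"

definition open_l1 :: "l1 set \<Rightarrow> bool"
  where "open_l1 S = (\<forall>x\<in>S. \<forall>\<^sub>F (x', y) in uniformity. x' = x \<longrightarrow> y \<in> S)"

instance
proof
  fix x y z :: l1 and a b :: real
  show "x + y + z = x + (y + z)" "x + y = y + x" "0 + x = x" "- x + x = 0" "x - y = x + - y"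
    by (transfer, simp add: fun_eq_iff)+
  show "a *\<^sub>R (x + y) = a *\<^sub>R x + a *\<^sub>R y" "(a + b) *\<^sub>R x = a *\<^sub>R x + b *\<^sub>R x"
    "a *\<^sub>R b *\<^sub>R x = (a * b) *\<^sub>R x" "1 *\<^sub>R x = x"
    by (transfer, simp add: fun_eq_iff algebra_simps)+
  show "norm x = 0 \<longleftrightarrow> x = 0"
    by transfer (simp add: suminf_eq_zero_iff fun_eq_iff)
  show "norm (x + y) \<le> norm x + norm y"
  proof transfer
    fix f g :: "nat \<Rightarrow> real"
    assume f: "summable (\<lambda>k. \<bar>f k\<bar>)" and g: "summable (\<lambda>k. \<bar>g k\<bar>)"
    have "summable (\<lambda>k. \<bar>f k + g k\<bar>)"
      by (rule summable_comparison_test'[OF summable_add[OF f g]]) auto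
    then have "(\<Sum>k. \<bar>f k + g k\<bar>) \<le> (\<Sum>k. \<bar>f k\<bar> + \<bar>g k\<bar>)"
      by (intro suminf_le summable_add f g) auto
    then show "(\<Sum>k. \<bar>f k + g k\<bar>) \<le> (\<Sum>k. \<bar>f k\<bar>) + (\<Sum>k. \<bar>g k\<bar>)"
      by (simp add: suminf_add[OF f g])
  qed
  show "norm (a *\<^sub>R x) = \<bar>a\<bar> * norm x"
    by transfer (simp add: abs_mult suminf_mult)
qed (simp_all add: dist_l1_def sgn_l1_def uniformity_l1_def open_l1_def)

end

lift_definition l1_unit :: "nat \<Rightarrow> l1" is "\<lambda>j k. if k = j then 1 else 0"
  by (rule summable_finite[of "{_}"]) auto


section \<open>Basic sequences\<close>

text \<open>Sequences are indexed from 0.\<close>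

definition schauder_basis :: "(nat \<Rightarrow> 'a::banach) \<Rightarrow> bool"
  where "schauder_basis e \<longleftrightarrow> (\<forall>x. \<exists>!a. (\<lambda>j. a j *\<^sub>R e j) sums x)"

definition basic_sequence :: "(nat \<Rightarrow> 'a::banach) \<Rightarrow> bool"
  where "basic_sequence u \<longleftrightarrow>
    (\<forall>x \<in> closure (span (range u)). \<exists>!a. (\<lambda>j. a j *\<^sub>R u j) sums x)"

text \<open>Summability over \<^term>\<open>UNIV\<close> is convergence along the finite subsets of the index set,
  i.e. unconditional convergence.\<close>

definition unconditional :: "(nat \<Rightarrow> 'a::banach) \<Rightarrow> bool"
  where "unconditional u \<longleftrightarrow> basic_sequence u \<and>
    (\<forall>a. summable (\<lambda>j. a j *\<^sub>R u j) \<longrightarrow> (\<lambda>j. a j *\<^sub>R u j) summable_on UNIV)"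

definition one_unconditional :: "(nat \<Rightarrow> 'a::banach) \<Rightarrow> bool"
  where "one_unconditional u \<longleftrightarrow> basic_sequence u \<and>
    (\<forall>(a :: nat \<Rightarrow> real) \<epsilon> n. (\<forall>j. \<epsilon> j \<in> {-1, 1}) \<longrightarrow>
      norm (\<Sum>j<n. (\<epsilon> j * a j) *\<^sub>R u j) = norm (\<Sum>j<n. a j *\<^sub>R u j))"

definition equivalent_seq ::
    "(nat \<Rightarrow> 'a::real_normed_vector) \<Rightarrow> (nat \<Rightarrow> 'b::real_normed_vector) \<Rightarrow> bool"
  where "equivalent_seq u v \<longleftrightarrow>
    (\<forall>a. summable (\<lambda>j. a j *\<^sub>R u j) \<longleftrightarrow> summable (\<lambda>j. a j *\<^sub>R v j))"

definition isometrically_equivalent_seq ::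
    "(nat \<Rightarrow> 'a::real_normed_vector) \<Rightarrow> (nat \<Rightarrow> 'b::real_normed_vector) \<Rightarrow> bool"
  where "isometrically_equivalent_seq u v \<longleftrightarrow>
    (\<forall>a n. norm (\<Sum>j<n. a j *\<^sub>R u j) = norm (\<Sum>j<n. a j *\<^sub>R v j))"

definition subsymmetric :: "(nat \<Rightarrow> 'a::banach) \<Rightarrow> bool"
  where "subsymmetric u \<longleftrightarrow> unconditional u \<and>
    (\<forall>r. strict_mono r \<longrightarrow> equivalent_seq u (u \<circ> r))"

definition one_subsymmetric :: "(nat \<Rightarrow> 'a::banach) \<Rightarrow> bool"
  where "one_subsymmetric u \<longleftrightarrow> one_unconditional u \<and>
    (\<forall>r. strict_mono r \<longrightarrow> isometrically_equivalent_seq u (u \<circ> r))"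


section \<open>Supports and shifts with respect to a basis\<close>

definition coord :: "(nat \<Rightarrow> 'a::banach) \<Rightarrow> 'a \<Rightarrow> nat \<Rightarrow> real"
  where "coord e x = (THE a. (\<lambda>j. a j *\<^sub>R e j) sums x)"

definition supp :: "(nat \<Rightarrow> 'a::banach) \<Rightarrow> 'a \<Rightarrow> nat set"
  where "supp e x = {j. coord e x j \<noteq> 0}"

text \<open>The maximum of the support of \<open>x\<close> has to exist, hence the finiteness condition.
  \<open>Max\<close> and \<open>Inf\<close> are only meaningful on nonempty supports, i.e. for nonzero vectors.\<close>

definition block_less :: "(nat \<Rightarrow> 'a::banach) \<Rightarrow> 'a \<Rightarrow> 'a \<Rightarrow> bool"
  where "block_less e x y \<longleftrightarrow> finite (supp e x) \<and> Max (supp e x) < Inf (supp e y)"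

definition right_shift :: "(nat \<Rightarrow> 'a::banach) \<Rightarrow> 'a \<Rightarrow> 'a \<Rightarrow> bool"
  where "right_shift e w z \<longleftrightarrow> (\<exists>m. (\<lambda>j. coord e z j *\<^sub>R e (j + m)) sums w)"


section \<open>Fundamental functions\<close>

definition fundamental :: "(nat \<Rightarrow> 'a::real_normed_vector) \<Rightarrow> nat \<Rightarrow> real"
  where "fundamental u n = norm (\<Sum>i<n. u i)"

definition equivalent_fundamental :: "(nat \<Rightarrow> real) \<Rightarrow> (nat \<Rightarrow> real) \<Rightarrow> bool"
  where "equivalent_fundamental \<phi> \<psi> \<longleftrightarrow>
    (\<exists>K>0. \<forall>n. inverse K * \<phi> n \<le> \<psi> n \<and> \<psi> n \<le> K * \<phi> n)"

end

theory Submission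
  imports Defs
begin

text \<open>
  The idea is to superpose, with rapidly decreasing weights, copies of finitely supported blocks each
  of which makes the fundamental function large at one scale, and to code a subset of the natural
  numbers by the choice of the scales.

  The hypothesis on right shifts gives, for every \<open>n \<ge> 2\<close>, a finite coefficient block of norm one such that \<open>n\<close>
  consecutive copies of it have a sum of norm at least \<open>n / 2\<close> (\<open>finite_profile_of_right_shifts\<close>).  Let
  \<open>b k\<close> be the block obtained for \<open>n = N k\<close> and, for a set \<open>A\<close> containing \<open>0\<close>, let the vector \<open>u i\<close> be the
  sum of \<open>weight k\<close> times a copy of \<open>b k\<close> over all \<open>k \<in> A\<close> with \<open>k \<le> i\<close>, where all copies are disjoint and
  ordered first by \<open>i\<close>, then by \<open>k\<close>.  Without the truncation \<open>k \<le> i\<close> such a sequence would be isometric to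
  its subsequences, because the norm only sees the order of the positions; but infinitely many blocks
  do not fit in front of the next vector.  The truncation is harmless since the omitted weights are
  summable over all \<open>i\<close>, and \<open>\<bar>a i\<bar>\<close> is bounded by the norm of \<open>\<Sum>i. a i *\<^sub>R u i\<close>, as \<open>0 \<in> A\<close>.  Hence
  the sequence is subsymmetric (\<open>subsymmetric_stack\<close>).

  If \<open>k \<in> A\<close>, the fundamental function at \<open>N k\<close> is at least of the order of \<open>weight k * N k\<close>
  (\<open>fundamental_stack_ge\<close>).  If \<open>k \<notin> A\<close>, it is smaller by a factor of the order of \<open>1 / Suc k\<close>
  (\<open>fundamental_stack_le\<close>): the blocks after
  the \<open>k\<close>-th have total weight at most \<open>weight k / Suc k\<close>, and the finitely many earlier blocks
  contribute at most a constant times the fundamental function of \<open>e\<close>.  The latter is sublinear along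
  arbitrarily large arguments, since otherwise an averaging argument would make \<open>e\<close> equivalent to the
  basis of the space of summable sequences (\<open>fundamental_sublinear\<close>); so \<open>N k\<close> can be chosen after the
  earlier blocks to make their contribution negligible (\<open>exists_block_sequence\<close>).  Two sets whose
  difference is infinite therefore give non-equivalent fundamental functions, and there is a
  continuum of sets, any two of which have an infinite difference in one of the two directions.
\<close>

section \<open>Norm estimates for a one-subsymmetric sequence\<close>

locale one_subsymmetric_sequence =
  fixes e :: "nat \<Rightarrow> 'a::banach"
  assumes one_subsymmetric: "one_subsymmetric e"
    and norm_e [simp]: "norm (e j) = 1"
begin

lemma norm_flip_signs:
  assumes "\<And>j. \<epsilon> j \<in> {-1, 1}"
  shows "norm (\<Sum>j<n. (\<epsilon> j * a j) *\<^sub>R e j) = norm (\<Sum>j<n. a j *\<^sub>R e j)"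
  using one_subsymmetric assms unfolding one_subsymmetric_def one_unconditional_def by blast

text \<open>
  The modified vector is a convex combination of the original one and its reflection in the \<open>i\<close>-th
  coordinate.
\<close>

lemma norm_shrink_one_coordinate:
  assumes "\<bar>t\<bar> \<le> \<bar>b i\<bar>"
  shows "norm (\<Sum>j<n. (b(i := t)) j *\<^sub>R e j) \<le> norm (\<Sum>j<n. b j *\<^sub>R e j)"
proof (cases "b i = 0")
  case True
  then have "b(i := t) = b"
    using assms by (auto simp: fun_eq_iff)
  then show ?thesis by simp
next
  case False
  define s where "s = t / b i"
  have s: "-1 \<le> s" "s \<le> 1" "t = s * b i"
  proof -
    have "\<bar>s\<bar> \<le> 1"
      unfolding s_def abs_divide using assms False by (subst divide_le_eq_1_pos) auto
    then show "-1 \<le> s" "s \<le> 1"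
      by (simp_all add: abs_le_iff)
    show "t = s * b i"
      using False by (simp add: s_def)
  qed
  let ?\<epsilon> = "\<lambda>j. if j = i then - 1 else (1::real)"
  have "(\<Sum>j<n. (b(i := t)) j *\<^sub>R e j)
      = ((1 + s) / 2) *\<^sub>R (\<Sum>j<n. b j *\<^sub>R e j) + ((1 - s) / 2) *\<^sub>R (\<Sum>j<n. (?\<epsilon> j * b j) *\<^sub>R e j)"
    unfolding scaleR_sum_right sum.distrib[symmetric]
    by (intro sum.cong) (auto simp: s algebra_simps simp flip: scaleR_add_left scaleR_diff_left add_divide_distrib)
  also have "norm \<dots> \<le> \<bar>(1 + s) / 2\<bar> * norm (\<Sum>j<n. b j *\<^sub>R e j)
      + \<bar>(1 - s) / 2\<bar> * norm (\<Sum>j<n. (?\<epsilon> j * b j) *\<^sub>R e j)"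
    by (rule order_trans[OF norm_triangle_ineq]) (simp only: norm_scaleR order_refl)
  also have "norm (\<Sum>j<n. (?\<epsilon> j * b j) *\<^sub>R e j) = norm (\<Sum>j<n. b j *\<^sub>R e j)"
    by (rule norm_flip_signs) auto
  finally show ?thesis
    using s by (simp add: field_simps)
qed

lemma norm_mono_initial:
  assumes "\<And>j. j < n \<Longrightarrow> \<bar>a j\<bar> \<le> \<bar>b j\<bar>"
  shows "norm (\<Sum>j<n. a j *\<^sub>R e j) \<le> norm (\<Sum>j<n. b j *\<^sub>R e j)"
proof -
  have "norm (\<Sum>j<n. (if j < m then a j else b j) *\<^sub>R e j) \<le> norm (\<Sum>j<n. b j *\<^sub>R e j)"
    if "m \<le> n" for m
    using that
  proof (induction m)
    case (Suc m)
    let ?b = "\<lambda>j. if j < m then a j else b j"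
    have "(\<lambda>j. if j < Suc m then a j else b j) = ?b(m := a m)"
      by (auto simp: fun_eq_iff less_Suc_eq)
    then show ?case
      using norm_shrink_one_coordinate[of "a m" ?b m n] assms[of m] Suc
      by (smt (verit, best) Suc_le_eq order_less_irrefl sum.cong nless_le)
  qed simp
  from this[of n] show ?thesis by simp
qed

lemma norm_spread_initial:
  assumes h: "strict_mono_on {..<m} h"
  shows "norm (\<Sum>i<m. a i *\<^sub>R e (h i)) = norm (\<Sum>i<m. a i *\<^sub>R e i)"
proof -
  define r where "r i = (if i < m then h i else h (m - 1) + i + 1)" for i
  have "strict_mono r"
  proof (rule strict_monoI)
    fix i j :: nat
    assume "i < j"
    consider "j < m" | "i < m" "m \<le> j" | "m \<le> i" by linarith
    then show "r i < r j"
    proof cases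
      case 2
      have "h i \<le> h (m - 1)"
        using 2 h by (cases "i = m - 1") (auto simp: strict_mono_on_def intro!: less_imp_le)
      with 2 show ?thesis by (simp add: r_def)
    qed (use \<open>i < j\<close> h in \<open>auto simp: r_def strict_mono_on_def\<close>)
  qed
  then have "norm (\<Sum>i<m. a i *\<^sub>R e i) = norm (\<Sum>i<m. a i *\<^sub>R (e \<circ> r) i)"
    using one_subsymmetric unfolding one_subsymmetric_def isometrically_equivalent_seq_def by blast
  also have "(\<Sum>i<m. a i *\<^sub>R (e \<circ> r) i) = (\<Sum>i<m. a i *\<^sub>R e (h i))"
    by (intro sum.cong) (auto simp: r_def)
  finally show ?thesis by simp
qed

text \<open>
  The two symmetries of the norm combined.  Indexing by an arbitrary finite set lets the same
  statement serve single vectors, pairs and triples of indices; only the relative order of the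
  positions \<open>p x\<close> matters, so both sides can be pushed down to an initial segment.
\<close>

lemma norm_dominated:
  fixes f g :: "'b \<Rightarrow> real" and p q :: "'b \<Rightarrow> nat"
  assumes fin: "finite E" and sub: "D \<subseteq> E"
    and le: "\<And>x. x \<in> D \<Longrightarrow> \<bar>f x\<bar> \<le> \<bar>g x\<bar>"
    and inj: "inj_on q E"
    and order: "\<And>x y. x \<in> D \<Longrightarrow> y \<in> D \<Longrightarrow> p x < p y \<longleftrightarrow> q x < q y"
  shows "norm (\<Sum>x\<in>D. f x *\<^sub>R e (p x)) \<le> norm (\<Sum>x\<in>E. g x *\<^sub>R e (q x))"
proof -
  \<comment> \<open>enumerate an index set in the order of its positions\<close>
  have enum: "\<exists>x. bij_betw x {..<card C} C \<and> strict_mono_on {..<card C} (q \<circ> x)" if "C \<subseteq> E" for C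
  proof -
    have inj_C: "inj_on q C" and fin_C: "finite C"
      using that inj fin by (auto intro: inj_on_subset finite_subset)
    obtain h where h: "bij_betw h {..<card (q ` C)} (q ` C)" "strict_mono_on {..<card (q ` C)} h"
      using ex_bij_betw_strict_mono_card[of "q ` C"] fin_C by blast
    have card: "card (q ` C) = card C"
      by (rule card_image[OF inj_C])
    let ?x = "the_inv_into C q \<circ> h"
    have "bij_betw ?x {..<card C} C"
      using h(1) card bij_betw_the_inv_into[OF inj_on_imp_bij_betw[OF inj_C]]
      by (metis bij_betw_trans)
    moreover have "q (?x i) = h i" if "i < card C" for i
    proof -
      have "h i \<in> q ` C"
        using bij_betwE[OF h(1)] card that by simp
      from f_the_inv_into_f[OF inj_C this] show ?thesis by simp
    qed
    then have "strict_mono_on {..<card C} (q \<circ> ?x)"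
      using h(2) card by (auto simp: strict_mono_on_def)
    ultimately show ?thesis by blast
  qed
  let ?f = "\<lambda>x. if x \<in> D then f x else 0"
  obtain x where x: "bij_betw x {..<card E} E" "strict_mono_on {..<card E} (q \<circ> x)"
    using enum[of E] by blast
  obtain y where y: "bij_betw y {..<card D} D" "strict_mono_on {..<card D} (q \<circ> y)"
    using enum[OF sub] by blast
  have mem: "y i \<in> D" if "i < card D" for i
    using y(1) that by (auto simp: bij_betw_def)
  have mono_p: "strict_mono_on {..<card D} (p \<circ> y)"
    using y(2) mem order by (auto simp: strict_mono_on_def)
  have "norm (\<Sum>x\<in>D. f x *\<^sub>R e (p x)) = norm (\<Sum>i<card D. f (y i) *\<^sub>R e ((p \<circ> y) i))"
    by (simp add: sum.reindex_bij_betw[OF y(1), symmetric])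
  also have "\<dots> = norm (\<Sum>i<card D. f (y i) *\<^sub>R e ((q \<circ> y) i))"
    using norm_spread_initial[OF mono_p, of "f \<circ> y"] norm_spread_initial[OF y(2), of "f \<circ> y"] by simp
  also have "(\<Sum>i<card D. f (y i) *\<^sub>R e ((q \<circ> y) i)) = (\<Sum>x\<in>D. f x *\<^sub>R e (q x))"
    by (simp add: sum.reindex_bij_betw[OF y(1), of "\<lambda>x. f x *\<^sub>R e (q x)"])
  also have "\<dots> = (\<Sum>x\<in>E. ?f x *\<^sub>R e (q x))"
    by (rule sum.mono_neutral_cong_left) (use fin sub in auto)
  also have "\<dots> = (\<Sum>i<card E. ?f (x i) *\<^sub>R e ((q \<circ> x) i))"
    by (simp only: o_def sum.reindex_bij_betw[OF x(1), of "\<lambda>x. ?f x *\<^sub>R e (q x)"])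
  also have "norm \<dots> = norm (\<Sum>i<card E. ?f (x i) *\<^sub>R e i)"
    using norm_spread_initial[OF x(2), of "?f \<circ> x"] by (simp only: o_def)
  also have "\<dots> \<le> norm (\<Sum>i<card E. g (x i) *\<^sub>R e i)"
    by (rule norm_mono_initial) (use le in auto)
  also have "\<dots> = norm (\<Sum>i<card E. g (x i) *\<^sub>R e ((q \<circ> x) i))"
    using norm_spread_initial[OF x(2), of "g \<circ> x"] by simp
  also have "\<dots> = norm (\<Sum>x\<in>E. g x *\<^sub>R e (q x))"
    by (simp add: sum.reindex_bij_betw[OF x(1), of "\<lambda>x. g x *\<^sub>R e (q x)"])
  finally show ?thesis .
qed

lemma norm_spread:
  fixes f :: "'b \<Rightarrow> real" and p q :: "'b \<Rightarrow> nat"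
  assumes "finite D" "inj_on q D"
    and "\<And>x y. x \<in> D \<Longrightarrow> y \<in> D \<Longrightarrow> p x < p y \<longleftrightarrow> q x < q y"
  shows "norm (\<Sum>x\<in>D. f x *\<^sub>R e (p x)) = norm (\<Sum>x\<in>D. f x *\<^sub>R e (q x))"
proof (rule antisym)
  have "inj_on p D"
    by (rule inj_onI) (metis assms inj_onD linorder_neqE_nat less_irrefl)
  then show "norm (\<Sum>x\<in>D. f x *\<^sub>R e (q x)) \<le> norm (\<Sum>x\<in>D. f x *\<^sub>R e (p x))"
    by (intro norm_dominated) (use assms in auto)
  show "norm (\<Sum>x\<in>D. f x *\<^sub>R e (p x)) \<le> norm (\<Sum>x\<in>D. f x *\<^sub>R e (q x))"
    by (intro norm_dominated) (use assms in auto)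
qed

lemma abs_coefficient_le:
  assumes "finite D" "i \<in> D"
  shows "\<bar>a i\<bar> \<le> norm (\<Sum>j\<in>D. a j *\<^sub>R e j)"
  using norm_dominated[of D "{i}" a a "\<lambda>x. x" "\<lambda>x. x"] assms by simp

end

section \<open>Criteria for unconditionality and equivalence\<close>

text \<open>
  Under this hypothesis the coefficient functionals are bounded on the span, with bound
  \<open>1 / norm (u j)\<close>, so coefficients of approximating finite sums converge; the bound on partial sums
  then allows the limits to be interchanged.
\<close>

lemma basic_sequence_if_suppression:
  fixes u :: "nat \<Rightarrow> 'a::banach"
  assumes nonzero: "\<And>j. u j \<noteq> 0"
    and mono: "\<And>a F G. finite G \<Longrightarrow> F \<subseteq> G \<Longrightarrow>
      norm (\<Sum>j\<in>F. a j *\<^sub>R u j) \<le> norm (\<Sum>j\<in>G. a j *\<^sub>R u j)"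
  shows "basic_sequence u"
  unfolding basic_sequence_def
proof (intro ballI)
  have partial_le: "norm (\<Sum>j<n. a j *\<^sub>R u j) \<le> norm x" if "(\<lambda>j. a j *\<^sub>R u j) sums x" for a x n
  proof (rule Lim_bounded2)
    show "(\<lambda>m. norm (\<Sum>j<m. a j *\<^sub>R u j)) \<longlonglongrightarrow> norm x"
      using that unfolding sums_def by (rule tendsto_norm)
    show "\<forall>m\<ge>n. norm (\<Sum>j<n. a j *\<^sub>R u j) \<le> norm (\<Sum>j<m. a j *\<^sub>R u j)"
      by (auto intro!: mono)
  qed
  have coefficient_le: "\<bar>a j\<bar> * norm (u j) \<le> norm x" if "(\<lambda>j. a j *\<^sub>R u j) sums x" for a x j
    using partial_le[OF that, of "Suc j"] mono[of "{..<Suc j}" "{j}" a] by simp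
  fix x assume "x \<in> closure (span (range u))"
  then obtain X where X: "\<And>n. X n \<in> span (range u)" "X \<longlonglongrightarrow> x"
    by (auto simp: closure_sequential)
  have span_sums: "\<exists>a. (\<lambda>j. a j *\<^sub>R u j) sums y" if "y \<in> span (range u)" for y
    using that
  proof (induction rule: span_induct_alt)
    case base
    then show ?case by (intro exI[of _ "\<lambda>_. 0"]) simp
  next
    case (step c v y)
    then obtain i a where ia: "v = u i" "(\<lambda>j. a j *\<^sub>R u j) sums y" by auto
    have "(\<lambda>j. (if j = i then c else 0) *\<^sub>R u j) sums (\<Sum>j\<in>{i}. (if j = i then c else 0) *\<^sub>R u j)"
      by (rule sums_finite) auto
    from sums_add[OF this ia(2)] have "(\<lambda>j. ((if j = i then c else 0) + a j) *\<^sub>R u j) sums (c *\<^sub>R v + y)"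
      using ia(1) by (simp add: scaleR_add_left)
    then show ?case
      by (intro exI[of _ "\<lambda>j. (if j = i then c else 0) + a j"])
  qed
  have "\<forall>n. \<exists>a. (\<lambda>j. a j *\<^sub>R u j) sums X n"
    using span_sums[OF X(1)] by (rule allI)
  from choice[OF this] obtain A where A: "\<And>n. (\<lambda>j. A n j *\<^sub>R u j) sums X n"
    by auto
  have diff: "(\<lambda>j. (A n j - A m j) *\<^sub>R u j) sums (X n - X m)" for n m
    using sums_diff[OF A A] by (simp add: scaleR_diff_left)
  have "convergent (\<lambda>n. A n j)" for j
  proof (rule Cauchy_convergent, rule CauchyI)
    fix \<epsilon> :: real assume "\<epsilon> > 0"
    then obtain M where M: "\<And>m n. m \<ge> M \<Longrightarrow> n \<ge> M \<Longrightarrow> norm (X m - X n) < \<epsilon> * norm (u j)"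
      using CauchyD[OF LIMSEQ_imp_Cauchy[OF X(2)], of "\<epsilon> * norm (u j)"] nonzero[of j] by auto
    have "norm (A m j - A n j) < \<epsilon>" if "m \<ge> M" "n \<ge> M" for m n
    proof -
      have "\<bar>A m j - A n j\<bar> * norm (u j) < \<epsilon> * norm (u j)"
        using coefficient_le[OF diff[of m n], of j] M[OF that] by linarith
      then show ?thesis using nonzero[of j] by simp
    qed
    then show "\<exists>M. \<forall>m\<ge>M. \<forall>n\<ge>M. norm (A m j - A n j) < \<epsilon>" by blast
  qed
  then have "\<forall>j. \<exists>l. (\<lambda>n. A n j) \<longlonglongrightarrow> l"
    unfolding convergent_def by (rule allI)
  from choice[OF this] obtain a where a: "\<And>j. (\<lambda>n. A n j) \<longlonglongrightarrow> a j"
    by auto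
  have "(\<lambda>j. a j *\<^sub>R u j) sums x"
    unfolding sums_def
  proof (rule LIMSEQ_I)
    fix \<epsilon> :: real assume "\<epsilon> > 0"
    then obtain M where M: "\<And>m n. m \<ge> M \<Longrightarrow> n \<ge> M \<Longrightarrow> norm (X m - X n) < \<epsilon> / 4"
      using CauchyD[OF LIMSEQ_imp_Cauchy[OF X(2)], of "\<epsilon> / 4"] by auto
    have near: "norm (X M - x) \<le> \<epsilon> / 4"
    proof (rule LIMSEQ_le_const2)
      show "(\<lambda>m. norm (X M - X m)) \<longlonglongrightarrow> norm (X M - x)"
        by (intro tendsto_intros X)
      show "\<exists>N. \<forall>n\<ge>N. norm (X M - X n) \<le> \<epsilon> / 4"
        using M by (meson less_imp_le order_refl)
    qed
    have partial_near: "norm (\<Sum>j<N. (A M j - a j) *\<^sub>R u j) \<le> \<epsilon> / 4" for N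
    proof (rule LIMSEQ_le_const2)
      show "(\<lambda>m. norm (\<Sum>j<N. (A M j - A m j) *\<^sub>R u j)) \<longlonglongrightarrow> norm (\<Sum>j<N. (A M j - a j) *\<^sub>R u j)"
        by (intro tendsto_intros a)
      show "\<exists>k. \<forall>n\<ge>k. norm (\<Sum>j<N. (A M j - A n j) *\<^sub>R u j) \<le> \<epsilon> / 4"
        using partial_le[OF diff] M by (meson less_imp_le order_refl order_trans)
    qed
    obtain N0 where N0: "\<And>N. N \<ge> N0 \<Longrightarrow> norm ((\<Sum>j<N. A M j *\<^sub>R u j) - X M) < \<epsilon> / 4"
      using LIMSEQ_D[OF A[unfolded sums_def], of "\<epsilon> / 4" M] \<open>\<epsilon> > 0\<close> by auto
    have "norm ((\<Sum>j<N. a j *\<^sub>R u j) - x) < \<epsilon>" if "N \<ge> N0" for N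
    proof -
      have "(\<Sum>j<N. a j *\<^sub>R u j) - x
          = ((\<Sum>j<N. A M j *\<^sub>R u j) - X M) + (X M - x) - (\<Sum>j<N. (A M j - a j) *\<^sub>R u j)"
        by (simp add: scaleR_diff_left sum_subtractf)
      also have "norm \<dots> \<le> norm ((\<Sum>j<N. A M j *\<^sub>R u j) - X M) + norm (X M - x)
          + norm (\<Sum>j<N. (A M j - a j) *\<^sub>R u j)"
        by (intro norm_triangle_le_diff add_mono norm_triangle_ineq order_refl)
      finally show ?thesis
        using N0[OF that] near partial_near[of N] \<open>\<epsilon> > 0\<close> by linarith
    qed
    then show "\<exists>N0. \<forall>N\<ge>N0. norm ((\<Sum>j<N. a j *\<^sub>R u j) - x) < \<epsilon>" by blast
  qed
  moreover have "b = a" if "(\<lambda>j. b j *\<^sub>R u j) sums x" "(\<lambda>j. a j *\<^sub>R u j) sums x" for a b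
  proof
    fix j
    have "(\<lambda>j. (b j - a j) *\<^sub>R u j) sums 0"
      using sums_diff[OF that] by (simp add: scaleR_diff_left)
    from coefficient_le[OF this, of j] nonzero[of j] show "b j = a j"
      by (simp add: mult_le_0_iff)
  qed
  ultimately show "\<exists>!a. (\<lambda>j. a j *\<^sub>R u j) sums x" by blast
qed

text \<open>
  Any finite set of indices beyond \<open>n\<close> is contained in an interval beyond \<open>n\<close>, whose sum is controlled by
  the Cauchy criterion for the ordered series.
\<close>

lemma unconditional_if_suppression:
  fixes u :: "nat \<Rightarrow> 'a::banach"
  assumes nonzero: "\<And>j. u j \<noteq> 0"
    and mono: "\<And>a F G. finite G \<Longrightarrow> F \<subseteq> G \<Longrightarrow>
      norm (\<Sum>j\<in>F. a j *\<^sub>R u j) \<le> norm (\<Sum>j\<in>G. a j *\<^sub>R u j)"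
  shows "unconditional u"
  unfolding unconditional_def
proof (intro conjI allI impI)
  show "basic_sequence u"
    by (rule basic_sequence_if_suppression[OF assms])
  fix a assume summable: "summable (\<lambda>j. a j *\<^sub>R u j)"
  let ?S = "\<Sum>j. a j *\<^sub>R u j"
  have "((\<lambda>j. a j *\<^sub>R u j) has_sum ?S) UNIV"
    unfolding has_sum_def
  proof (rule tendstoI)
    fix \<epsilon> :: real assume "\<epsilon> > 0"
    then obtain N where N: "\<And>m n. m \<ge> N \<Longrightarrow> norm (\<Sum>j=m..<n. a j *\<^sub>R u j) < \<epsilon> / 2"
      using summable[unfolded summable_Cauchy, rule_format, of "\<epsilon> / 2"] by auto
    obtain N' where N': "\<And>n. n \<ge> N' \<Longrightarrow> norm ((\<Sum>j<n. a j *\<^sub>R u j) - ?S) < \<epsilon> / 2"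
      using LIMSEQ_D[OF summable_LIMSEQ[OF summable], of "\<epsilon> / 2"] \<open>\<epsilon> > 0\<close> by auto
    let ?n = "max N N'"
    have "dist (\<Sum>j\<in>F. a j *\<^sub>R u j) ?S < \<epsilon>" if F: "finite F" "{..<?n} \<subseteq> F" for F
    proof -
      obtain m where m: "F \<subseteq> {..<m}"
        using finite_nat_iff_bounded F(1) by blast
      have "norm (\<Sum>j\<in>F - {..<?n}. a j *\<^sub>R u j) \<le> norm (\<Sum>j=?n..<m. a j *\<^sub>R u j)"
        by (rule mono) (use m in auto)
      also have "\<dots> < \<epsilon> / 2"
        by (rule N) simp
      finally have tail: "norm (\<Sum>j\<in>F - {..<?n}. a j *\<^sub>R u j) < \<epsilon> / 2" .
      have head: "norm ((\<Sum>j<?n. a j *\<^sub>R u j) - ?S) < \<epsilon> / 2"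
        by (rule N') simp
      have "(\<Sum>j\<in>F. a j *\<^sub>R u j) - ?S
          = (\<Sum>j\<in>F - {..<?n}. a j *\<^sub>R u j) + ((\<Sum>j<?n. a j *\<^sub>R u j) - ?S)"
        by (simp add: sum.subset_diff[OF F(2,1)])
      then show ?thesis
        using norm_triangle_lt[OF add_strict_mono[OF tail head]]
        by (simp only: dist_norm field_sum_of_halves)
    qed
    then show "\<forall>\<^sub>F F in finite_subsets_at_top UNIV. dist (\<Sum>j\<in>F. a j *\<^sub>R u j) ?S < \<epsilon>"
      unfolding eventually_finite_subsets_at_top by (intro exI[of _ "{..<?n}"]) auto
  qed
  then show "(\<lambda>j. a j *\<^sub>R u j) summable_on UNIV"
    unfolding summable_on_def by blast
qed

lemma summable_if_norm_sum_le:
  fixes f :: "nat \<Rightarrow> 'a::banach" and g :: "nat \<Rightarrow> 'b::banach"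
  assumes "summable g"
    and le: "\<And>F. finite F \<Longrightarrow> norm (sum f F) \<le> C * norm (sum g F)"
  shows "summable f"
  unfolding summable_Cauchy
proof (intro allI impI)
  fix \<epsilon> :: real assume "\<epsilon> > 0"
  then obtain N where N: "\<And>m n. m \<ge> N \<Longrightarrow> norm (sum g {m..<n}) < \<epsilon> / (\<bar>C\<bar> + 1)"
    using \<open>summable g\<close>[unfolded summable_Cauchy, rule_format, of "\<epsilon> / (\<bar>C\<bar> + 1)"] by auto
  have "norm (sum f {m..<n}) < \<epsilon>" if "m \<ge> N" for m n
  proof -
    have "norm (sum f {m..<n}) \<le> C * norm (sum g {m..<n})"
      by (rule le) simp
    also have "\<dots> \<le> (\<bar>C\<bar> + 1) * norm (sum g {m..<n})"
      by (rule mult_right_mono) auto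
    also have "\<dots> < \<epsilon>"
      using N[OF that, of n] by (simp add: pos_less_divide_eq mult.commute)
    finally show ?thesis .
  qed
  then show "\<exists>N. \<forall>m\<ge>N. \<forall>n. norm (sum f {m..<n}) < \<epsilon>" by blast
qed

section \<open>The unit vector basis of the space of absolutely summable sequences\<close>

lemma l1_nth_sum_unit: "l1_nth (\<Sum>j<n. a j *\<^sub>R l1_unit j) k = (if k < n then a k else 0)"
proof (induction n)
  case 0
  then show ?case by (simp add: zero_l1.rep_eq)
next
  case (Suc n)
  then show ?case
    by (simp add: plus_l1.rep_eq scaleR_l1.rep_eq l1_unit.rep_eq less_Suc_eq)
qed

lemma norm_sum_l1_unit: "norm (\<Sum>j<n. a j *\<^sub>R l1_unit j) = (\<Sum>j<n. \<bar>a j\<bar>)"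
proof -
  have "(\<Sum>k. \<bar>if k < n then a k else 0\<bar>) = (\<Sum>k<n. \<bar>if k < n then a k else 0\<bar>)"
    by (rule suminf_finite) auto
  then show ?thesis
    by (simp add: norm_l1.rep_eq l1_nth_sum_unit)
qed

lemma summable_scaleR_l1_unit:
  "summable (\<lambda>j. a j *\<^sub>R l1_unit j) \<longleftrightarrow> summable (\<lambda>j. \<bar>a j\<bar>)"
proof
  assume "summable (\<lambda>j. a j *\<^sub>R l1_unit j)"
  then have "Bseq (\<lambda>n. \<Sum>j<n. a j *\<^sub>R l1_unit j)"
    by (intro convergent_imp_Bseq) (simp add: summable_iff_convergent)
  then obtain K where "\<And>n. norm (\<Sum>j<n. a j *\<^sub>R l1_unit j) \<le> K"
    by (auto simp: Bseq_def)
  then show "summable (\<lambda>j. \<bar>a j\<bar>)"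
    by (intro summableI_nonneg_bounded) (auto simp: norm_sum_l1_unit)
next
  assume summable: "summable (\<lambda>j. \<bar>a j\<bar>)"
  have nth: "l1_nth (Abs_l1 a) = a"
    by (rule Abs_l1_inverse) (use summable in simp)
  have "norm ((\<Sum>j<n. a j *\<^sub>R l1_unit j) - Abs_l1 a) = (\<Sum>j. \<bar>a j\<bar>) - (\<Sum>j<n. \<bar>a j\<bar>)" for n
  proof -
    let ?f = "\<lambda>k. if k < n then \<bar>a k\<bar> else 0"
    have f: "?f sums (\<Sum>j<n. ?f j)"
      by (rule sums_finite) auto
    have "norm ((\<Sum>j<n. a j *\<^sub>R l1_unit j) - Abs_l1 a) = (\<Sum>k. \<bar>a k\<bar> - ?f k)"
      by (auto simp: norm_l1.rep_eq minus_l1.rep_eq l1_nth_sum_unit nth intro!: suminf_cong)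
    also have "\<dots> = (\<Sum>k. \<bar>a k\<bar>) - (\<Sum>j<n. ?f j)"
      using sums_unique[OF sums_diff[OF summable_sums[OF summable] f]] by simp
    finally show ?thesis by simp
  qed
  moreover have "(\<lambda>n. (\<Sum>j. \<bar>a j\<bar>) - (\<Sum>j<n. \<bar>a j\<bar>)) \<longlonglongrightarrow> (\<Sum>j. \<bar>a j\<bar>) - (\<Sum>j. \<bar>a j\<bar>)"
    by (intro tendsto_intros summable_LIMSEQ summable)
  ultimately have "(\<lambda>n. norm ((\<Sum>j<n. a j *\<^sub>R l1_unit j) - Abs_l1 a)) \<longlonglongrightarrow> 0"
    by simp
  then have "(\<lambda>j. a j *\<^sub>R l1_unit j) sums Abs_l1 a"
    unfolding sums_def by (rule LIM_zero_cancel[OF tendsto_norm_zero_cancel])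
  then show "summable (\<lambda>j. a j *\<^sub>R l1_unit j)"
    by (rule sums_summable)
qed

section \<open>Sublinear growth of the fundamental function\<close>

context one_subsymmetric_sequence
begin

text \<open>
  For \<open>M \<ge> m\<close>, adding \<open>2 * M\<close> consecutive right shifts of \<open>\<Sum>j<m. \<bar>a j\<bar> *\<^sub>R e j\<close> produces at each of the \<open>M\<close> positions
  \<open>{M..<2 * M}\<close> the full sum of the \<open>\<bar>a j\<bar>\<close>, while all the shifts have the same norm.
\<close>

lemma linear_fundamental_imp_l1_estimate:
  assumes "\<delta> \<ge> 0" and linear: "\<And>n. n \<ge> n0 \<Longrightarrow> \<delta> * real n \<le> fundamental e n"
  shows "\<delta> / 2 * (\<Sum>j<m. \<bar>a j\<bar>) \<le> norm (\<Sum>j<m. a j *\<^sub>R e j)"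
proof -
  \<comment> \<open>large enough for the linear lower bound at \<open>M\<close>, and positive; the shifts stay below \<open>3 * M\<close>\<close>
  define M where "M = m + n0 + 1"
  define \<alpha> where "\<alpha> = (\<Sum>j<m. \<bar>a j\<bar>)"
  define g where "g t = (\<Sum>j<m. if t \<in> {j..<j + 2 * M} then \<bar>a j\<bar> else 0)" for t
  have "(\<Sum>s<2 * M. \<Sum>j<m. \<bar>a j\<bar> *\<^sub>R e (j + s)) = (\<Sum>j<m. \<Sum>s<2 * M. \<bar>a j\<bar> *\<^sub>R e (j + s))"
    by (rule sum.swap)
  also have "\<dots> = (\<Sum>j<m. \<Sum>t\<in>{j..<j + 2 * M}. \<bar>a j\<bar> *\<^sub>R e t)"
    by (intro sum.cong[OF refl] sum.reindex_bij_witness[of _ "\<lambda>t. t - j" "\<lambda>s. j + s" for j]) auto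
  also have "\<dots> = (\<Sum>j<m. \<Sum>t<3 * M. (if t \<in> {j..<j + 2 * M} then \<bar>a j\<bar> else 0) *\<^sub>R e t)"
    by (intro sum.cong[OF refl] sum.mono_neutral_cong_left) (auto simp: M_def)
  also have "\<dots> = (\<Sum>t<3 * M. g t *\<^sub>R e t)"
    unfolding g_def scaleR_sum_left by (rule sum.swap)
  finally have shifts: "(\<Sum>s<2 * M. \<Sum>j<m. \<bar>a j\<bar> *\<^sub>R e (j + s)) = (\<Sum>t<3 * M. g t *\<^sub>R e t)" .
  have "\<alpha> \<ge> 0"
    by (simp add: \<alpha>_def sum_nonneg)
  have full: "g t = \<alpha>" if "t \<in> {M..<2 * M}" for t
    unfolding g_def \<alpha>_def using that by (intro sum.cong) (auto simp: M_def)
  have "\<alpha> * (\<delta> * M) \<le> \<alpha> * fundamental e M"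
    using linear[of M] \<open>\<alpha> \<ge> 0\<close> by (intro mult_left_mono) (auto simp: M_def)
  also have "\<dots> = norm (\<Sum>t<M. \<alpha> *\<^sub>R e t)"
    using \<open>\<alpha> \<ge> 0\<close> by (simp add: fundamental_def flip: scaleR_sum_right)
  also have "\<dots> = norm (\<Sum>t<M. \<alpha> *\<^sub>R e (t + M))"
    by (rule norm_spread_initial[symmetric]) (simp add: strict_mono_on_def)
  also have "(\<Sum>t<M. \<alpha> *\<^sub>R e (t + M)) = (\<Sum>t\<in>{M..<2 * M}. \<alpha> *\<^sub>R e t)"
    by (rule sum.reindex_bij_witness[of _ "\<lambda>t. t - M" "\<lambda>t. t + M"]) auto
  also have "norm \<dots> \<le> norm (\<Sum>t<3 * M. g t *\<^sub>R e t)"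
    by (rule norm_dominated) (use full in auto)
  also have "\<dots> \<le> (\<Sum>s<2 * M. norm (\<Sum>j<m. \<bar>a j\<bar> *\<^sub>R e (j + s)))"
    unfolding shifts[symmetric] by (rule norm_sum)
  also have "\<dots> = (\<Sum>s<2 * M. norm (\<Sum>j<m. \<bar>a j\<bar> *\<^sub>R e j))"
    by (intro sum.cong[OF refl] norm_spread_initial) (simp add: strict_mono_on_def)
  also have "\<dots> = 2 * M * norm (\<Sum>j<m. \<bar>a j\<bar> *\<^sub>R e j)"
    by simp
  also have "\<dots> \<le> 2 * M * norm (\<Sum>j<m. a j *\<^sub>R e j)"
    by (intro mult_left_mono norm_mono_initial) auto
  finally have "real M * (\<delta> * \<alpha>) \<le> real M * (2 * norm (\<Sum>j<m. a j *\<^sub>R e j))"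
    by (simp add: algebra_simps)
  then have "\<delta> * \<alpha> \<le> 2 * norm (\<Sum>j<m. a j *\<^sub>R e j)"
    by (subst (asm) mult_le_cancel_left_pos) (auto simp: M_def)
  then show ?thesis
    by (simp add: \<alpha>_def)
qed

lemma fundamental_sublinear:
  assumes not_l1: "\<not> equivalent_seq e l1_unit" and "\<delta> > 0"
  shows "\<exists>n\<ge>n0. fundamental e n \<le> \<delta> * real n"
proof (rule ccontr)
  assume "\<not> ?thesis"
  then have linear: "\<delta> * real n \<le> fundamental e n" if "n \<ge> n0" for n
    using that by force
  have "summable (\<lambda>j. a j *\<^sub>R e j) \<longleftrightarrow> summable (\<lambda>j. \<bar>a j\<bar>)" for a
  proof
    assume "summable (\<lambda>j. a j *\<^sub>R e j)"
    then have "Bseq (\<lambda>n. \<Sum>j<n. a j *\<^sub>R e j)"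
      by (intro convergent_imp_Bseq) (simp add: summable_iff_convergent)
    then obtain K where K: "\<And>n. norm (\<Sum>j<n. a j *\<^sub>R e j) \<le> K"
      by (auto simp: Bseq_def)
    have "(\<Sum>j<n. \<bar>a j\<bar>) \<le> 2 * K / \<delta>" for n
      using linear_fundamental_imp_l1_estimate[of \<delta> n0 a n, OF _ linear] K[of n] \<open>\<delta> > 0\<close>
      by (simp add: field_simps)
    then show "summable (\<lambda>j. \<bar>a j\<bar>)"
      by (intro summableI_nonneg_bounded) auto
  next
    assume "summable (\<lambda>j. \<bar>a j\<bar>)"
    then show "summable (\<lambda>j. a j *\<^sub>R e j)"
      by (intro summable_norm_cancel[of "\<lambda>j. a j *\<^sub>R e j"]) (simp only: norm_scaleR norm_e mult_1_right)
  qed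
  then have "equivalent_seq e l1_unit"
    by (simp add: equivalent_seq_def summable_scaleR_l1_unit)
  with not_l1 show False by simp
qed

end

section \<open>Consecutive copies of a finitely supported vector\<close>

lemma block_position_less_iff:
  fixes p :: "nat \<Rightarrow> nat"
  assumes "i < i' \<Longrightarrow> p i + L \<le> p i'" "i' < i \<Longrightarrow> p i' + L \<le> p i" "l < L" "l' < L"
  shows "p i + l < p i' + l' \<longleftrightarrow> i < i' \<or> i = i' \<and> l < l'"
proof (cases i i' rule: linorder_cases)
  case less
  then show ?thesis using assms(1)[OF less] assms(3) by simp
next
  case greater
  then show ?thesis using assms(2)[OF greater] assms(4) by simp
qed simp

context one_subsymmetric_sequence
begin

lemma norm_spread_blocks:
  fixes p q :: "nat \<Rightarrow> nat"
  assumes "finite I"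
    and p: "\<And>i i'. i \<in> I \<Longrightarrow> i' \<in> I \<Longrightarrow> i < i' \<Longrightarrow> p i + L \<le> p i'"
    and q: "\<And>i i'. i \<in> I \<Longrightarrow> i' \<in> I \<Longrightarrow> i < i' \<Longrightarrow> q i + L \<le> q i'"
  shows "norm (\<Sum>i\<in>I. \<Sum>l<L. b l *\<^sub>R e (p i + l)) = norm (\<Sum>i\<in>I. \<Sum>l<L. b l *\<^sub>R e (q i + l))"
proof -
  have less_p: "p i + l < p i' + l' \<longleftrightarrow> i < i' \<or> i = i' \<and> l < l'"
    if "i \<in> I" "i' \<in> I" "l < L" "l' < L" for i i' l l'
    by (rule block_position_less_iff) (use p that in auto)
  have less_q: "q i + l < q i' + l' \<longleftrightarrow> i < i' \<or> i = i' \<and> l < l'"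
    if "i \<in> I" "i' \<in> I" "l < L" "l' < L" for i i' l l'
    by (rule block_position_less_iff) (use q that in auto)
  have "norm (\<Sum>x\<in>I \<times> {..<L}. b (snd x) *\<^sub>R e (p (fst x) + snd x))
      = norm (\<Sum>x\<in>I \<times> {..<L}. b (snd x) *\<^sub>R e (q (fst x) + snd x))"
  proof (rule norm_spread)
    show "inj_on (\<lambda>x. q (fst x) + snd x) (I \<times> {..<L})"
    proof (rule inj_onI, clarsimp)
      fix i l i' l'
      assume "i \<in> I" "i' \<in> I" "l < L" "l' < L" "q i + l = q i' + l'"
      then show "i = i' \<and> l = l'"
        using less_q[of i i' l l'] less_q[of i' i l' l] by auto
    qed
  next
    fix x y
    assume "x \<in> I \<times> {..<L}" "y \<in> I \<times> {..<L}"
    then show "p (fst x) + snd x < p (fst y) + snd y \<longleftrightarrow> q (fst x) + snd x < q (fst y) + snd y"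
      by (cases x; cases y) (simp add: less_p less_q)
  qed (use \<open>finite I\<close> in auto)
  then show ?thesis
    by (simp add: sum.cartesian_product split_beta)
qed

end

text \<open>
  A vector with finite support and unit norm is determined up to a spread by its coefficients \<open>b\<close> on
  the interval from the first to the last point of its support, and disjoint right shifts of it
  occupy successive translates of that interval.
\<close>

lemma finite_profile_of_right_shifts:
  fixes e :: "nat \<Rightarrow> 'a::banach" and z :: "nat \<Rightarrow> 'a"
  assumes basis: "schauder_basis e"
    and sub: "one_subsymmetric e" and normalized: "\<forall>j. norm (e j) = 1"
    and n: "n \<ge> 2"
    and unit: "\<forall>i<n. norm (z i) = 1"
    and blocks: "\<forall>i. Suc i < n \<longrightarrow> block_less e (z i) (z (Suc i))"
    and shifts: "\<forall>i<n. right_shift e (z i) (z 0)"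
    and large: "norm (\<Sum>i<n. z i) \<ge> real n / 2"
  shows "\<exists>L b. norm (\<Sum>l<L. b l *\<^sub>R e l) = 1 \<and> norm (\<Sum>i<n. \<Sum>l<L. b l *\<^sub>R e (i * L + l)) \<ge> real n / 2"
proof -
  interpret one_subsymmetric_sequence e
    by (rule one_subsymmetric_sequence.intro) (use sub normalized in auto)
  have coord_eq: "coord e x = c" if "(\<lambda>j. c j *\<^sub>R e j) sums x" for x c
    unfolding coord_def using basis that
    by (intro the1_equality) (auto simp: schauder_basis_def)
  have sums_coord: "(\<lambda>j. coord e x j *\<^sub>R e j) sums x" for x
    unfolding coord_def using basis
    by (intro theI'[of "\<lambda>c. (\<lambda>j. c j *\<^sub>R e j) sums x"]) (auto simp: schauder_basis_def)
  define a where "a = coord e (z 0)"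
  define S where "S = {j. a j \<noteq> 0}"
  have "block_less e (z 0) (z (Suc 0))"
    using blocks n by auto
  then have finS: "finite S"
    by (simp add: block_less_def supp_def S_def a_def)
  have "S \<noteq> {}"
  proof
    assume "S = {}"
    then have "a j = 0" for j
      by (auto simp: S_def)
    then have "z 0 = 0"
      using sums_coord[of "z 0"] by (simp add: a_def sums_iff)
    then show False
      using unit[rule_format, of 0] n by simp
  qed
  define p where "p = Min S"
  define q where "q = Max S"
  define L where "L = Suc q - p"
  define b where "b l = a (p + l)" for l
  have pq: "p \<in> S" "q \<in> S" "p \<le> q"
    using finS \<open>S \<noteq> {}\<close> by (auto simp: p_def q_def)
  have S_between: "p \<le> j \<and> j \<le> q" if "j \<in> S" for j
    using finS that by (auto simp: p_def q_def)
  have "\<forall>i. \<exists>m. i < n \<longrightarrow> (\<lambda>j. a j *\<^sub>R e (j + m)) sums z i"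
    using shifts by (auto simp: right_shift_def a_def)
  from choice[OF this] obtain m where m: "\<And>i. i < n \<Longrightarrow> (\<lambda>j. a j *\<^sub>R e (j + m i)) sums z i"
    by auto
  have z_eq: "z i = (\<Sum>l<L. b l *\<^sub>R e (p + m i + l))" if "i < n" for i
  proof -
    have "(\<lambda>j. a j *\<^sub>R e (j + m i)) sums (\<Sum>j\<in>{p..q}. a j *\<^sub>R e (j + m i))"
      by (rule sums_finite) (use S_between in \<open>auto simp: S_def\<close>)
    then have "z i = (\<Sum>j\<in>{p..q}. a j *\<^sub>R e (j + m i))"
      using m[OF that] sums_unique2 by blast
    also have "\<dots> = (\<Sum>l<L. b l *\<^sub>R e (p + m i + l))"
      by (rule sum.reindex_bij_witness[of _ "\<lambda>l. p + l" "\<lambda>j. j - p"])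
        (use \<open>p \<le> q\<close> in \<open>auto simp: b_def L_def add_ac\<close>)
    finally show ?thesis .
  qed
  have supp_z: "supp e (z i) = (\<lambda>j. j + m i) ` S" if "i < n" for i
  proof -
    let ?c = "\<lambda>j. if m i \<le> j then a (j - m i) else 0"
    have "(\<lambda>j. ?c j *\<^sub>R e j) sums (\<Sum>j\<in>{p + m i..q + m i}. ?c j *\<^sub>R e j)"
    proof (rule sums_finite)
      fix j
      assume "j \<notin> {p + m i..q + m i}"
      then show "?c j *\<^sub>R e j = 0"
        using S_between[of "j - m i"] by (cases "m i \<le> j \<and> a (j - m i) \<noteq> 0") (auto simp: S_def)
    qed simp
    also have "(\<Sum>j\<in>{p + m i..q + m i}. ?c j *\<^sub>R e j) = (\<Sum>l<L. b l *\<^sub>R e (p + m i + l))"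
      by (rule sum.reindex_bij_witness[of _ "\<lambda>l. p + m i + l" "\<lambda>j. j - (p + m i)"])
        (use \<open>p \<le> q\<close> in \<open>auto simp: b_def L_def add_ac\<close>)
    finally have "(\<lambda>j. ?c j *\<^sub>R e j) sums z i"
      by (simp only: z_eq[OF that])
    then have "coord e (z i) = ?c"
      by (rule coord_eq[where c = ?c])
    then show ?thesis
      by (auto simp: supp_def S_def image_iff intro!: exI[of _ "_ - m i"])
  qed
  have step: "p + m i + L \<le> p + m (Suc i)" if "Suc i < n" for i
  proof -
    have "Max (supp e (z i)) < Inf (supp e (z (Suc i)))"
      using blocks that by (auto simp: block_less_def)
    moreover have "q + m i \<le> Max (supp e (z i))"
      using that finS pq by (intro Max_ge) (auto simp: supp_z)
    moreover have "Inf (supp e (z (Suc i))) \<le> p + m (Suc i)"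
      using that pq by (intro cInf_lower) (auto simp: supp_z)
    ultimately show ?thesis
      using \<open>p \<le> q\<close> by (simp add: L_def)
  qed
  have separated: "p + m i + L \<le> p + m i'" if "i < i'" "i' < n" for i i'
    using that
  proof (induction i')
    case (Suc i')
    then show ?case
      using step[of i'] by (cases "i = i'") auto
  qed simp
  have "norm (\<Sum>l<L. b l *\<^sub>R e l) = norm (\<Sum>l<L. b l *\<^sub>R e (p + m 0 + l))"
    by (rule norm_spread_initial[symmetric]) (simp add: strict_mono_on_def)
  then have block_unit: "norm (\<Sum>l<L. b l *\<^sub>R e l) = 1"
    using z_eq[of 0] unit[rule_format, of 0] n by simp
  have "norm (\<Sum>i<n. z i) = norm (\<Sum>i<n. \<Sum>l<L. b l *\<^sub>R e (p + m i + l))"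
    by (simp add: z_eq)
  also have "\<dots> = norm (\<Sum>i<n. \<Sum>l<L. b l *\<^sub>R e (i * L + l))"
  proof (rule norm_spread_blocks)
    show "i * L + L \<le> i' * L" if "i < i'" for i i'
      using mult_le_mono1[of "Suc i" i' L] that by simp
    show "p + m i + L \<le> p + m i'" if "i \<in> {..<n}" "i' \<in> {..<n}" "i < i'" for i i'
      by (rule separated) (use that in auto)
  qed simp
  finally show ?thesis
    using large block_unit by (intro exI[of _ L] exI[of _ b]) (simp only: simp_thms)
qed

section \<open>Stacking copies of blocks\<close>

locale stacked_blocks = one_subsymmetric_sequence +
  fixes L :: "nat \<Rightarrow> nat" and b :: "nat \<Rightarrow> nat \<Rightarrow> real"
  assumes norm_block: "norm (\<Sum>l<L k. b k l *\<^sub>R e l) = 1"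
begin

definition offset :: "nat \<Rightarrow> nat"
  where "offset k = (\<Sum>j<k. L j)"

text \<open>
  The \<open>i\<close>-th vector is allotted the total length of the blocks \<open>b 0, \<dots>, b i\<close>, which is
  \<open>offset (Suc i)\<close>.
\<close>

definition position :: "nat \<Rightarrow> nat \<Rightarrow> nat"
  where "position i k = (\<Sum>i'<i. offset (Suc i')) + offset k"

definition copy :: "nat \<Rightarrow> nat \<Rightarrow> 'a"
  where "copy i k = (\<Sum>l<L k. b k l *\<^sub>R e (position i k + l))"

lemma position_less_iff:
  assumes "k \<le> i" "l < L k" "k' \<le> i'" "l' < L k'"
  shows "position i k + l < position i' k' + l' \<longleftrightarrow>
    i < i' \<or> i = i' \<and> (k < k' \<or> k = k' \<and> l < l')"
proof -
  have offset_step: "offset k + l < offset k'" if "l < L k" "k < k'" for k l k'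
  proof -
    have "offset k + l < (\<Sum>j<Suc k. L j)"
      using that(1) by (simp add: offset_def)
    also have "\<dots> \<le> offset k'"
      unfolding offset_def by (rule sum_mono2) (use that(2) in auto)
    finally show ?thesis .
  qed
  have later: "position i k + l < position i' k' + l'" if "i < i'" "k \<le> i" "l < L k" for i k l i' k' l'
  proof -
    have "position i k + l < (\<Sum>j<Suc i. offset (Suc j))"
      using offset_step[of l k "Suc i"] that by (simp add: position_def)
    also have "\<dots> \<le> (\<Sum>j<i'. offset (Suc j))"
      by (rule sum_mono2) (use that in auto)
    finally show ?thesis
      by (simp add: position_def)
  qed
  have same: "position i k + l < position i k' + l'" if "k < k'" "l < L k" for i k l k' l'
    using offset_step[of l k k'] that by (simp add: position_def)
  consider "i < i'" | "i' < i" | "i = i'" "k < k'" | "i = i'" "k' < k" | "i = i'" "k = k'"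
    by linarith
  then show ?thesis
  proof cases
    case 1
    then show ?thesis using later[of i i' k l k' l'] assms by simp
  next
    case 2
    then show ?thesis using later[of i' i k' l' k l] assms by simp
  next
    case 3
    then show ?thesis using same[of k k' l i l'] assms by simp
  next
    case 4
    then show ?thesis using same[of k' k l' i l] assms by simp
  qed simp
qed

lemma norm_copy [simp]: "norm (copy i k) = 1"
  unfolding copy_def norm_block[of k, symmetric]
  by (rule norm_spread_initial) (simp add: strict_mono_on_def)

lemma abs_block_le_1: "l < L k \<Longrightarrow> \<bar>b k l\<bar> \<le> 1"
  using abs_coefficient_le[of "{..<L k}" l "b k"] norm_block[of k] by simp

text \<open>
  Combinations of copies are compared coefficientwise.  Reindexing the copies by strictly increasing
  maps \<open>r\<close>, \<open>s\<close> preserves the order of their positions, which is all the norm depends on.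
\<close>

lemma norm_copies_dominated:
  fixes I J :: "nat set"
  assumes "finite J" "I \<subseteq> J"
    and r: "strict_mono_on I r" and s: "strict_mono_on J s"
    and K: "\<And>i. i \<in> I \<Longrightarrow> K i \<subseteq> K' i" "\<And>i. i \<in> I \<Longrightarrow> K i \<subseteq> {..r i}" "\<And>i. i \<in> J \<Longrightarrow> K' i \<subseteq> {..s i}"
    and le: "\<And>i k. i \<in> I \<Longrightarrow> k \<in> K i \<Longrightarrow> \<bar>f i k\<bar> \<le> \<bar>g i k\<bar>"
  shows "norm (\<Sum>i\<in>I. \<Sum>k\<in>K i. f i k *\<^sub>R copy (r i) k) \<le> norm (\<Sum>i\<in>J. \<Sum>k\<in>K' i. g i k *\<^sub>R copy (s i) k)"
proof -
  let ?D = "Sigma I (\<lambda>i. Sigma (K i) (\<lambda>k. {..<L k}))"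
  let ?E = "Sigma J (\<lambda>i. Sigma (K' i) (\<lambda>k. {..<L k}))"
  let ?pos = "\<lambda>r (i, k, l). position (r i) k + l"
  have expand: "(\<Sum>i\<in>I. \<Sum>k\<in>K i. f i k *\<^sub>R copy (r i) k)
      = (\<Sum>x\<in>Sigma I (\<lambda>i. Sigma (K i) (\<lambda>k. {..<L k})).
          (case x of (i, k, l) \<Rightarrow> f i k * b k l) *\<^sub>R e (?pos r x))"
    if "finite I" "\<forall>i\<in>I. finite (K i)" for I :: "nat set" and K f r
    using that by (simp add: copy_def scaleR_sum_right sum.Sigma split_beta)
  have less_iff: "?pos r x < ?pos r y \<longleftrightarrow> fst x < fst y \<or>
      fst x = fst y \<and> (fst (snd x) < fst (snd y) \<or> fst (snd x) = fst (snd y) \<and> snd (snd x) < snd (snd y))"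
    if "strict_mono_on I r" "\<forall>i\<in>I. K i \<subseteq> {..r i}"
      "x \<in> Sigma I (\<lambda>i. Sigma (K i) (\<lambda>k. {..<L k}))" "y \<in> Sigma I (\<lambda>i. Sigma (K i) (\<lambda>k. {..<L k}))"
    for I :: "nat set" and K r x y
  proof -
    obtain i k l i' k' l' where xy: "x = (i, k, l)" "y = (i', k', l')"
      by (metis surj_pair)
    have mem: "i \<in> I" "i' \<in> I" "k \<le> r i" "k' \<le> r i'" "l < L k" "l' < L k'"
      using that(2-4) xy by auto
    have mono: "r j < r j'" if "j \<in> I" "j' \<in> I" "j < j'" for j j'
      using \<open>strict_mono_on I r\<close> that by (simp add: strict_mono_on_def)
    have "r i < r i' \<longleftrightarrow> i < i'" "r i = r i' \<longleftrightarrow> i = i'"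
      using mono[of i i'] mono[of i' i] mem by (cases i i' rule: linorder_cases; simp)+
    then show ?thesis
      using position_less_iff[of k "r i" l k' "r i'" l'] mem xy by simp
  qed
  have K_r: "\<forall>i\<in>I. K i \<subseteq> {..r i}" and K_s: "\<forall>i\<in>J. K' i \<subseteq> {..s i}"
    using K(2,3) by auto
  have finite_I: "finite I" "\<forall>i\<in>I. finite (K i)"
    using \<open>finite J\<close> \<open>I \<subseteq> J\<close> K(2) by (auto intro: finite_subset)
  have finite_J: "\<forall>i\<in>J. finite (K' i)"
    using K(3) by (auto intro: finite_subset)
  have "norm (\<Sum>x\<in>?D. (case x of (i, k, l) \<Rightarrow> f i k * b k l) *\<^sub>R e (?pos r x))
      \<le> norm (\<Sum>x\<in>?E. (case x of (i, k, l) \<Rightarrow> g i k * b k l) *\<^sub>R e (?pos s x))"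
  proof (rule norm_dominated)
    show "finite ?E"
      using \<open>finite J\<close> finite_J by auto
    show sub: "?D \<subseteq> ?E"
      using \<open>I \<subseteq> J\<close> K(1) by auto
    show "\<bar>case x of (i, k, l) \<Rightarrow> f i k * b k l\<bar> \<le> \<bar>case x of (i, k, l) \<Rightarrow> g i k * b k l\<bar>" if "x \<in> ?D" for x
      using that le by (auto simp: abs_mult mult_right_mono)
    show "inj_on (?pos s) ?E"
    proof (rule inj_onI)
      fix x y
      assume xy: "x \<in> ?E" "y \<in> ?E" and "?pos s x = ?pos s y"
      then show "x = y"
        using less_iff[OF s K_s xy] less_iff[OF s K_s xy(2,1)]
        by (metis less_irrefl linorder_neqE_nat prod_eqI)
    qed
    show "?pos r x < ?pos r y \<longleftrightarrow> ?pos s x < ?pos s y" if "x \<in> ?D" "y \<in> ?D" for x y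
      unfolding less_iff[OF r K_r that] less_iff[OF s K_s subsetD[OF sub that(1)] subsetD[OF sub that(2)]] ..
  qed
  then show ?thesis
    unfolding expand[OF finite_I] expand[OF \<open>finite J\<close> finite_J] .
qed

end

section \<open>Weighted stacks of blocks\<close>

text \<open>
  The factorial makes every tail of the weights small compared with the preceding weight.
\<close>

definition weight :: "nat \<Rightarrow> real"
  where "weight k = 1 / fact (Suc k)"

lemma weight_pos [simp]: "weight k > 0" and weight_nonneg [simp]: "weight k \<ge> 0"
  by (simp_all add: weight_def)

lemma weight_le_1: "weight k \<le> 1"
  by (simp add: weight_def field_simps del: fact_Suc)

text \<open>
  Since \<open>j * weight j = 1 / fact j - 1 / fact (Suc j)\<close>, the sum telescopes.
\<close>

lemma weight_tail: "(\<Sum>j=Suc k..<M. weight j) \<le> weight k / real (Suc k)"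
proof -
  have bound: "(\<Sum>j=Suc k..<M. real (Suc k) * weight j) \<le> weight k - 1 / fact M" if "Suc k \<le> M"
    using that
  proof (induction M rule: dec_induct)
    case base
    then show ?case by (simp add: weight_def)
  next
    case (step M)
    have "real (Suc k) * weight M \<le> real M * weight M"
      using step.hyps by (intro mult_right_mono) auto
    also have "\<dots> = real (Suc M) / fact (Suc M) - 1 / fact (Suc M)"
      by (simp add: weight_def add_divide_distrib del: fact_Suc)
    also have "real (Suc M) / fact (Suc M) = 1 / fact M"
      by (simp add: fact_Suc del: of_nat_Suc)
    finally show ?case
      using step by (simp add: sum.atLeastLessThan_Suc del: fact_Suc)
  qed
  have "real (Suc k) * (\<Sum>j=Suc k..<M. weight j) \<le> weight k"
  proof (cases "Suc k \<le> M")
    case True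
    have "1 / (fact M :: real) \<ge> 0"
      by simp
    with bound[OF True] show ?thesis
      unfolding sum_distrib_left by linarith
  qed simp
  then show ?thesis
    by (simp only: pos_le_divide_eq of_nat_0_less_iff zero_less_Suc mult.commute)
qed

lemma weight_tail_le_weight: "(\<Sum>j=Suc k..<M. weight j) \<le> weight k"
proof -
  have "weight k / real (Suc k) \<le> weight k / 1"
    by (intro divide_left_mono) auto
  with weight_tail[of k M] show ?thesis by simp
qed

lemma sum_weight_le_2:
  assumes "finite F"
  shows "sum weight F \<le> 2"
proof -
  obtain M where "F \<subseteq> {..<M}"
    using finite_nat_iff_bounded assms by blast
  then have "sum weight F \<le> (\<Sum>j<Suc M. weight j)"
    by (intro sum_mono2) auto
  also have "\<dots> = weight 0 + (\<Sum>j=Suc 0..<Suc M. weight j)"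
    by (simp add: sum.atLeast_Suc_lessThan lessThan_atLeast0 del: sum.op_ivl_Suc)
  also have "\<dots> \<le> 2"
    using weight_tail_le_weight[of 0 "Suc M"] weight_le_1[of 0] by linarith
  finally show ?thesis .
qed

context stacked_blocks
begin

definition selected_weight :: "nat set \<Rightarrow> nat \<Rightarrow> real"
  where "selected_weight A k = (if k \<in> A then weight k else 0)"

text \<open>
  Only the copies with \<open>k \<le> i\<close> fit in front of the next vector, so this is a truncation of an infinite
  combination of blocks.
\<close>

definition stack :: "nat set \<Rightarrow> nat \<Rightarrow> 'a"
  where "stack A i = (\<Sum>k\<le>i. selected_weight A k *\<^sub>R copy i k)"

lemma selected_weight_nonneg [simp]: "selected_weight A k \<ge> 0"
  and selected_weight_le: "selected_weight A k \<le> weight k"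
  by (simp_all add: selected_weight_def)

lemma sum_scaled_stacks:
  "(\<Sum>i\<in>F. a i *\<^sub>R stack A (r i)) = (\<Sum>i\<in>F. \<Sum>k\<in>{..r i}. (a i * selected_weight A k) *\<^sub>R copy (r i) k)"
  by (simp add: stack_def scaleR_sum_right)

lemma norm_stacks_mono:
  assumes "finite G" "F \<subseteq> G"
  shows "norm (\<Sum>i\<in>F. a i *\<^sub>R stack A i) \<le> norm (\<Sum>i\<in>G. a i *\<^sub>R stack A i)"
  unfolding sum_scaled_stacks[where r = "\<lambda>i. i"]
  by (rule norm_copies_dominated) (use assms in \<open>auto simp: strict_mono_on_def\<close>)

text \<open>
  As \<open>0 \<in> A\<close>, every vector contains a copy of the block with index \<open>0\<close>, with weight one.
\<close>

lemma abs_stack_coefficient_le: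
  assumes "0 \<in> A" "finite F" "i \<in> F"
  shows "\<bar>a i\<bar> \<le> norm (\<Sum>j\<in>F. a j *\<^sub>R stack A j)"
proof -
  have "\<bar>a i\<bar> = norm (\<Sum>j\<in>{i}. \<Sum>k\<in>{0}. a j *\<^sub>R copy j k)"
    by simp
  also have "\<dots> \<le> norm (\<Sum>j\<in>F. a j *\<^sub>R stack A j)"
    unfolding sum_scaled_stacks[where r = "\<lambda>i. i"]
    by (rule norm_copies_dominated)
      (use assms in \<open>auto simp: strict_mono_on_def selected_weight_def weight_def\<close>)
  finally show ?thesis .
qed

lemma stack_nonzero: "0 \<in> A \<Longrightarrow> stack A i \<noteq> 0"
  using abs_stack_coefficient_le[of A "{i}" i "\<lambda>_. 1"] by auto

text \<open>
  Passing to a subsequence lengthens the truncations, which only adds copies.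
\<close>

lemma norm_stacks_le_subsequence:
  assumes "finite F" "strict_mono r"
  shows "norm (\<Sum>i\<in>F. a i *\<^sub>R stack A i) \<le> norm (\<Sum>i\<in>F. a i *\<^sub>R stack A (r i))"
proof -
  have mono: "strict_mono_on F r" and le: "\<And>i. i \<le> r i"
    using assms(2) by (auto simp: strict_mono_on_def strict_mono_def intro: seq_suble)
  show ?thesis
    unfolding sum_scaled_stacks sum_scaled_stacks[where r = "\<lambda>i. i"]
    by (intro norm_copies_dominated)
      (use assms(1) mono in \<open>auto simp: strict_mono_on_def intro: order_trans[OF _ le]\<close>)
qed

text \<open>
  Conversely, the copies that the subsequence adds to the \<open>i\<close>-th vector have total weight at most
  \<open>weight i\<close>, and the coefficients are bounded by the norm on the right; as the weights sum to at most
  two, the constant is \<open>1 + 2\<close>.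
\<close>

lemma norm_subsequence_le_stacks:
  assumes "0 \<in> A" "finite F" "strict_mono r"
  shows "norm (\<Sum>i\<in>F. a i *\<^sub>R stack A (r i)) \<le> 3 * norm (\<Sum>i\<in>F. a i *\<^sub>R stack A i)"
proof -
  let ?X = "norm (\<Sum>i\<in>F. a i *\<^sub>R stack A i)"
  define tail where "tail i = (\<Sum>k=Suc i..<Suc (r i). selected_weight A k *\<^sub>R copy (r i) k)" for i
  have mono: "strict_mono_on F r" and le: "\<And>i. i \<le> r i"
    using assms(3) by (auto simp: strict_mono_on_def strict_mono_def intro: seq_suble)
  have split: "stack A (r i) = (\<Sum>k\<le>i. selected_weight A k *\<^sub>R copy (r i) k) + tail i" for i
  proof -
    have "{..r i} = {..i} \<union> {Suc i..<Suc (r i)}" "{..i} \<inter> {Suc i..<Suc (r i)} = {}"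
      using le[of i] by auto
    then show ?thesis
      unfolding stack_def tail_def by (simp add: sum.union_disjoint del: sum.op_ivl_Suc)
  qed
  have norm_tail: "norm (tail i) \<le> weight i" for i
  proof -
    have "norm (tail i) \<le> (\<Sum>k=Suc i..<Suc (r i). weight k)"
      unfolding tail_def by (rule sum_norm_le) (simp add: selected_weight_le)
    also have "\<dots> \<le> weight i"
      by (rule weight_tail_le_weight)
    finally show ?thesis .
  qed
  let ?head = "\<Sum>i\<in>F. \<Sum>k\<in>{..i}. (a i * selected_weight A k) *\<^sub>R copy (r i) k"
  have "(\<Sum>i\<in>F. a i *\<^sub>R stack A (r i)) = ?head + (\<Sum>i\<in>F. a i *\<^sub>R tail i)"
    by (simp add: split scaleR_add_right scaleR_sum_right sum.distrib)
  then have "norm (\<Sum>i\<in>F. a i *\<^sub>R stack A (r i)) \<le> norm ?head + norm (\<Sum>i\<in>F. a i *\<^sub>R tail i)"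
    by (simp only: norm_triangle_ineq)
  moreover have "norm ?head \<le> ?X"
    unfolding sum_scaled_stacks[where r = "\<lambda>i. i"]
    by (rule norm_copies_dominated)
      (use assms(2) mono in \<open>auto simp: strict_mono_on_def intro: order_trans[OF _ le]\<close>)
  moreover have "norm (\<Sum>i\<in>F. a i *\<^sub>R tail i) \<le> ?X * 2"
  proof -
    have "norm (\<Sum>i\<in>F. a i *\<^sub>R tail i) \<le> (\<Sum>i\<in>F. ?X * weight i)"
      using abs_stack_coefficient_le[OF assms(1,2)] norm_tail
      by (intro sum_norm_le) (auto intro!: mult_mono)
    also have "\<dots> \<le> ?X * 2"
      unfolding sum_distrib_left[symmetric] by (intro mult_left_mono sum_weight_le_2 assms) auto
    finally show ?thesis .
  qed
  ultimately show ?thesis by linarith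
qed

lemma subsymmetric_stack:
  assumes "0 \<in> A"
  shows "subsymmetric (stack A)"
  unfolding subsymmetric_def
proof (intro conjI allI impI)
  show "unconditional (stack A)"
    by (rule unconditional_if_suppression) (simp_all add: stack_nonzero assms norm_stacks_mono)
  fix r :: "nat \<Rightarrow> nat"
  assume r: "strict_mono r"
  show "equivalent_seq (stack A) (stack A \<circ> r)"
    unfolding equivalent_seq_def
  proof (intro allI iffI)
    fix a
    assume "summable (\<lambda>j. a j *\<^sub>R stack A j)"
    then show "summable (\<lambda>j. a j *\<^sub>R (stack A \<circ> r) j)"
      by (rule summable_if_norm_sum_le[where C = 3])
        (use norm_subsequence_le_stacks[OF assms _ r] in simp)
  next
    fix a
    assume "summable (\<lambda>j. a j *\<^sub>R (stack A \<circ> r) j)"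
    then show "summable (\<lambda>j. a j *\<^sub>R stack A j)"
      by (rule summable_if_norm_sum_le[where C = 1])
        (use norm_stacks_le_subsequence[OF _ r] in simp)
  qed
qed

section \<open>Fundamental functions of weighted stacks\<close>

text \<open>
  The \<open>k\<close>-th block is missing from the first \<open>k\<close> vectors, which costs at most \<open>k\<close> in norm.
\<close>

lemma fundamental_stack_ge:
  assumes "k \<in> A"
    and large: "norm (\<Sum>i<n. \<Sum>l<L k. b k l *\<^sub>R e (i * L k + l)) \<ge> real n / 2"
  shows "fundamental (stack A) n \<ge> weight k * (real n / 2 - real k)"
proof (cases "k \<le> n")
  case False
  then have "weight k * (real n / 2 - real k) \<le> 0"
    by (intro mult_nonneg_nonpos) auto
  also have "\<dots> \<le> fundamental (stack A) n"
    by (simp add: fundamental_def)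
  finally show ?thesis .
next
  case True
  let ?B = "\<lambda>i. \<Sum>l<L k. b k l *\<^sub>R e (i * L k + l)"
  have norm_B: "norm (?B i) = 1" for i
    unfolding norm_block[of k, symmetric] by (rule norm_spread_initial) (simp add: strict_mono_on_def)
  have "L k > 0"
    using norm_block[of k] by (cases "L k = 0") auto
  have "real n / 2 \<le> norm (\<Sum>i<n. ?B i)"
    by (rule large)
  also have "(\<Sum>i<n. ?B i) = (\<Sum>i<k. ?B i) + (\<Sum>i=k..<n. ?B i)"
    using True by (subst sum.union_disjoint[symmetric]) (auto simp: ivl_disj_un)
  also have "norm \<dots> \<le> norm (\<Sum>i<k. ?B i) + norm (\<Sum>i=k..<n. ?B i)"
    by (rule norm_triangle_ineq)
  also have "norm (\<Sum>i<k. ?B i) \<le> (\<Sum>i<k. 1)"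
    by (rule sum_norm_le) (simp add: norm_B)
  also have "norm (\<Sum>i=k..<n. ?B i) = norm (\<Sum>i=k..<n. copy i k)"
    unfolding copy_def
  proof (rule norm_spread_blocks)
    show "i * L k + L k \<le> i' * L k" if "i < i'" for i i'
      using mult_le_mono1[of "Suc i" i' "L k"] that by simp
    show "position i k + L k \<le> position i' k" if "i \<in> {k..<n}" "i' \<in> {k..<n}" "i < i'" for i i'
      using position_less_iff[of k i "L k - 1" k i' 0] that \<open>L k > 0\<close> by simp
  qed simp
  finally have "real n / 2 - real k \<le> norm (\<Sum>i=k..<n. copy i k)"
    by simp
  then have "weight k * (real n / 2 - real k) \<le> weight k * norm (\<Sum>i=k..<n. copy i k)"
    by (intro mult_left_mono) auto
  also have "\<dots> = norm (\<Sum>i=k..<n. \<Sum>j\<in>{k}. weight k *\<^sub>R copy i j)"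
    by (simp flip: scaleR_sum_right)
  also have "\<dots> \<le> norm (\<Sum>i<n. \<Sum>j\<in>{..i}. selected_weight A j *\<^sub>R copy i j)"
    by (rule norm_copies_dominated) (use \<open>k \<in> A\<close> in \<open>auto simp: strict_mono_on_def selected_weight_def\<close>)
  also have "\<dots> = fundamental (stack A) n"
    by (simp add: fundamental_def stack_def)
  finally show ?thesis .
qed

lemma norm_sum_copies_le:
  "norm (\<Sum>i=j..<n. copy i j) \<le> real (L j) * fundamental e n"
proof -
  have "(\<Sum>i=j..<n. copy i j) = (\<Sum>l<L j. \<Sum>i=j..<n. b j l *\<^sub>R e (position i j + l))"
    unfolding copy_def by (rule sum.swap)
  also have "norm \<dots> \<le> (\<Sum>l<L j. fundamental e n)"
  proof (rule sum_norm_le)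
    fix l
    assume l: "l \<in> {..<L j}"
    have "norm (\<Sum>i\<in>{j..<n}. b j l *\<^sub>R e (position i j + l)) \<le> norm (\<Sum>i<n. 1 *\<^sub>R e i)"
    proof (rule norm_dominated)
      show "position i j + l < position i' j + l \<longleftrightarrow> i < i'"
        if "i \<in> {j..<n}" "i' \<in> {j..<n}" for i i'
        using position_less_iff[of j i l j i' l] that l by auto
    qed (use l abs_block_le_1 in auto)
    then show "norm (\<Sum>i=j..<n. b j l *\<^sub>R e (position i j + l)) \<le> fundamental e n"
      by (simp add: fundamental_def)
  qed
  finally show ?thesis by simp
qed

text \<open>
  Without the \<open>k\<close>-th block, the earlier blocks are bounded by finitely many spreads of \<open>e\<close>, and the
  later blocks by their total weight.
\<close>

lemma fundamental_stack_le:
  assumes "k \<notin> A"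
  shows "fundamental (stack A) n
    \<le> real (offset k) * fundamental e n + weight k / real (Suc k) * real n"
proof -
  let ?w = "selected_weight A" and ?\<phi> = "fundamental e n"
  let ?early = "\<lambda>j. if j < k then real (L j) * ?\<phi> else 0"
  let ?late = "\<lambda>j. if k < j then weight j * real n else 0"
  have "?\<phi> \<ge> 0"
    by (simp add: fundamental_def)
  have "(\<Sum>i<n. stack A i) = (\<Sum>i<n. \<Sum>j<n. if j \<le> i then ?w j *\<^sub>R copy i j else 0)"
    unfolding stack_def by (intro sum.cong[OF refl] sum.mono_neutral_cong_left) auto
  also have "\<dots> = (\<Sum>j<n. \<Sum>i<n. if j \<le> i then ?w j *\<^sub>R copy i j else 0)"
    by (rule sum.swap)
  also have "\<dots> = (\<Sum>j<n. \<Sum>i=j..<n. ?w j *\<^sub>R copy i j)"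
    by (intro sum.cong[OF refl] sum.mono_neutral_cong_right) auto
  also have "\<dots> = (\<Sum>j<n. ?w j *\<^sub>R (\<Sum>i=j..<n. copy i j))"
    by (simp add: scaleR_sum_right)
  finally have "fundamental (stack A) n = norm (\<Sum>j<n. ?w j *\<^sub>R (\<Sum>i=j..<n. copy i j))"
    by (simp add: fundamental_def)
  also have "\<dots> \<le> (\<Sum>j<n. ?early j + ?late j)"
  proof (rule sum_norm_le)
    fix j
    consider "j < k" | "j = k" | "k < j" by linarith
    then show "norm (?w j *\<^sub>R (\<Sum>i=j..<n. copy i j)) \<le> ?early j + ?late j"
    proof cases
      case 1
      have "?w j \<le> 1"
        using selected_weight_le[of A j] weight_le_1[of j] by linarith
      then have "?w j * norm (\<Sum>i=j..<n. copy i j) \<le> 1 * (real (L j) * ?\<phi>)"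
        by (intro mult_mono norm_sum_copies_le) auto
      with 1 show ?thesis by simp
    next
      case 2
      then show ?thesis using assms by (simp add: selected_weight_def)
    next
      case 3
      have "norm (\<Sum>i=j..<n. copy i j) \<le> (\<Sum>i=j..<n. 1)"
        by (rule sum_norm_le) simp
      then have "norm (\<Sum>i=j..<n. copy i j) \<le> real n"
        by simp
      then have "?w j * norm (\<Sum>i=j..<n. copy i j) \<le> weight j * real n"
        by (intro mult_mono selected_weight_le) auto
      with 3 show ?thesis by simp
    qed
  qed
  also have "\<dots> = (\<Sum>j<n. ?early j) + (\<Sum>j<n. ?late j)"
    by (rule sum.distrib)
  also have "(\<Sum>j<n. ?early j) \<le> (\<Sum>j<max k n. ?early j)"
    using \<open>?\<phi> \<ge> 0\<close> by (intro sum_mono2) auto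
  also have "\<dots> = (\<Sum>j<k. real (L j) * ?\<phi>)"
    by (rule sum.mono_neutral_cong_right) auto
  also have "\<dots> = real (offset k) * ?\<phi>"
    by (simp add: offset_def sum_distrib_right)
  also have "(\<Sum>j<n. ?late j) = (\<Sum>j=Suc k..<n. weight j * real n)"
    by (rule sum.mono_neutral_cong_right) auto
  also have "\<dots> \<le> weight k / real (Suc k) * real n"
    unfolding sum_distrib_right[symmetric] by (intro mult_right_mono weight_tail) auto
  finally show ?thesis by simp
qed

text \<open>
  At \<open>N k\<close>, the \<open>k\<close>-th block still contributes a fixed fraction of its weight times \<open>N k\<close>, whereas
  all the other blocks together contribute \<open>1 / Suc k\<close> times that.
\<close>

lemma fundamental_stack_not_dominated:
  assumes profile: "\<And>k. norm (\<Sum>i<N k. \<Sum>l<L k. b k l *\<^sub>R e (i * L k + l)) \<ge> real (N k) / 2"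
    and N: "\<And>k. N k \<ge> 4 * k" "\<And>k. N k > 0"
    and growth: "\<And>k. real (offset k) * fundamental e (N k) \<le> weight k / real (Suc k) * real (N k)"
    and inf: "infinite (A - B)"
  shows "\<exists>n. fundamental (stack A) n > K * fundamental (stack B) n"
proof (rule ccontr)
  assume "\<not> ?thesis"
  then have le: "fundamental (stack A) n \<le> K * fundamental (stack B) n" for n
    by (meson not_less)
  obtain m :: nat where m: "8 * \<bar>K\<bar> < real m"
    using reals_Archimedean2 by blast
  obtain k where k: "k \<ge> m" "k \<in> A" "k \<notin> B"
    using inf by (metis Diff_iff finite_nat_set_iff_bounded_le nat_le_linear)
  define t where "t = weight k * real (N k)"
  have "t > 0"
    using N(2)[of k] by (simp add: t_def)
  have "t / 4 \<le> weight k * (real (N k) / 2 - real k)"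
    using N(1)[of k] mult_left_mono[of "real (N k) / 4" "real (N k) / 2 - real k" "weight k"]
    by (simp add: t_def)
  also have "\<dots> \<le> fundamental (stack A) (N k)"
    by (rule fundamental_stack_ge) (use k profile in auto)
  also have "\<dots> \<le> K * fundamental (stack B) (N k)"
    by (rule le)
  also have "\<dots> \<le> \<bar>K\<bar> * fundamental (stack B) (N k)"
    by (intro mult_right_mono) (auto simp: fundamental_def)
  also have "\<dots> \<le> \<bar>K\<bar> * (2 * (t / real (Suc k)))"
    using fundamental_stack_le[OF k(3), of "N k"] growth[of k]
    by (intro mult_left_mono) (auto simp: t_def)
  finally have "t * real (Suc k) \<le> t * (8 * \<bar>K\<bar>)"
    by (simp add: field_simps del: of_nat_Suc)
  then have "real (Suc k) \<le> 8 * \<bar>K\<bar>"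
    using \<open>t > 0\<close> by (simp only: mult_le_cancel_left_pos)
  with m k(1) show False by linarith
qed

end

section \<open>Choosing the blocks\<close>

text \<open>
  Block lengths and scales are chosen alternately: the lengths of the blocks already chosen bound the
  early part of a stack by a multiple of the fundamental function of \<open>e\<close>, which is sublinear, so the
  next scale can be taken so large that this part is negligible there.
\<close>

lemma exists_block_sequence:
  fixes e :: "nat \<Rightarrow> 'a::banach"
  assumes "one_subsymmetric_sequence e"
    and not_l1: "\<not> equivalent_seq e l1_unit"
    and profiles: "\<forall>n\<ge>2. \<exists>L b. norm (\<Sum>l<L. b l *\<^sub>R e l) = 1 \<and>
      norm (\<Sum>i<n. \<Sum>l<L. b l *\<^sub>R e (i * L + l)) \<ge> real n / 2"
  shows "\<exists>(N :: nat \<Rightarrow> nat) L b. \<forall>k. norm (\<Sum>l<L k. b k l *\<^sub>R e l) = 1 \<and>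
    norm (\<Sum>i<N k. \<Sum>l<L k. b k l *\<^sub>R e (i * L k + l)) \<ge> real (N k) / 2 \<and>
    N k \<ge> 4 * k \<and> N k > 0 \<and>
    real (\<Sum>j<k. L j) * fundamental e (N k) \<le> weight k / real (Suc k) * real (N k)"
proof -
  interpret one_subsymmetric_sequence e by fact
  have "\<forall>n. \<exists>L. \<exists>b. n \<ge> 2 \<longrightarrow> norm (\<Sum>l<L. b l *\<^sub>R e l) = 1 \<and>
      norm (\<Sum>i<n. \<Sum>l<L. b l *\<^sub>R e (i * L + l)) \<ge> real n / 2"
    using profiles by simp
  from choice[OF this] obtain len where "\<forall>n. \<exists>b. n \<ge> 2 \<longrightarrow> norm (\<Sum>l<len n. b l *\<^sub>R e l) = 1 \<and>
      norm (\<Sum>i<n. \<Sum>l<len n. b l *\<^sub>R e (i * len n + l)) \<ge> real n / 2" ..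
  from choice[OF this] obtain coef where
    "\<forall>n. n \<ge> 2 \<longrightarrow> norm (\<Sum>l<len n. coef n l *\<^sub>R e l) = 1 \<and>
      norm (\<Sum>i<n. \<Sum>l<len n. coef n l *\<^sub>R e (i * len n + l)) \<ge> real n / 2" ..
  then have unit: "norm (\<Sum>l<len n. coef n l *\<^sub>R e l) = 1"
    and large: "norm (\<Sum>i<n. \<Sum>l<len n. coef n l *\<^sub>R e (i * len n + l)) \<ge> real n / 2" if "n \<ge> 2" for n
    using that by auto
  \<comment> \<open>sublinearity is used with \<open>s + 1\<close> in place of \<open>s\<close>, as \<open>s\<close> may vanish\<close>
  have scale: "\<exists>n. n \<ge> 2 \<and> n \<ge> 4 * k \<and>
      real s * fundamental e n \<le> weight k / real (Suc k) * real n" for k s :: nat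
  proof -
    obtain n where n: "n \<ge> max 2 (4 * k)"
      "fundamental e n \<le> weight k / real (Suc k) / (real s + 1) * real n"
      using fundamental_sublinear[OF not_l1, of "weight k / real (Suc k) / (real s + 1)" "max 2 (4 * k)"]
      by (auto simp del: of_nat_Suc)
    have "real s * fundamental e n \<le> (real s + 1) * fundamental e n"
      by (intro mult_right_mono) (auto simp: fundamental_def)
    also have "\<dots> \<le> (real s + 1) * (weight k / real (Suc k) / (real s + 1) * real n)"
      by (intro mult_left_mono n) auto
    also have "\<dots> = weight k / real (Suc k) * real n"
    proof -
      have "(s + 1) * (x / (s + 1) * y) = x * y" if "s \<ge> 0" for s x y :: real
        using that by (simp add: field_simps)
      then show ?thesis by simp
    qed
    finally show ?thesis
      using n(1) by auto
  qed
  \<comment> \<open>the state after step \<open>k\<close> is the scale and the total length of all earlier blocks\<close>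
  define P where "P k x \<longleftrightarrow> (k = 0 \<longrightarrow> snd x = 0) \<and> fst x \<ge> 2 \<and> fst x \<ge> 4 * k \<and>
      real (snd x) * fundamental e (fst x) \<le> weight k / real (Suc k) * real (fst x)"
    for k and x :: "nat \<times> nat"
  define Q where "Q k x y \<longleftrightarrow> snd y = snd x + len (fst x)" for k :: nat and x y :: "nat \<times> nat"
  have "\<exists>x. P 0 x"
  proof -
    obtain n where "n \<ge> 2 \<and> n \<ge> 4 * 0 \<and>
        real 0 * fundamental e n \<le> weight 0 / real (Suc 0) * real n"
      using scale[of 0 0] by blast
    then show ?thesis
      by (intro exI[of _ "(n, 0)"]) (simp add: P_def)
  qed
  moreover have "\<exists>y. P (Suc k) y \<and> Q k x y" for x k
  proof -
    let ?s = "snd x + len (fst x)"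
    obtain n where "n \<ge> 2 \<and> n \<ge> 4 * Suc k \<and>
        real ?s * fundamental e n \<le> weight (Suc k) / real (Suc (Suc k)) * real n"
      using scale[of "Suc k" ?s] by blast
    then show ?thesis
      by (intro exI[of _ "(n, ?s)"]) (simp add: P_def Q_def del: of_nat_Suc of_nat_add)
  qed
  ultimately obtain f where f: "\<And>k. P k (f k)" "\<And>k. Q k (f k) (f (Suc k))"
    using dependent_nat_choice[of P Q] by blast
  have total: "snd (f k) = (\<Sum>j<k. len (fst (f j)))" for k
  proof (induction k)
    case 0
    then show ?case using f(1)[of 0] by (simp add: P_def)
  next
    case (Suc k)
    then show ?case using f(2)[of k] by (simp add: Q_def)
  qed
  have ge: "fst (f k) \<ge> 2" "fst (f k) \<ge> 4 * k"
    and growth: "real (snd (f k)) * fundamental e (fst (f k)) \<le> weight k / real (Suc k) * real (fst (f k))"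
    for k
    using f(1)[of k] unfolding P_def by blast+
  show ?thesis
  proof (intro exI allI conjI)
    fix k
    show "fst (f k) > 0"
      using ge(1)[of k] by linarith
    show "real (\<Sum>j<k. len (fst (f j))) * fundamental e (fst (f k))
        \<le> weight k / real (Suc k) * real (fst (f k))"
      using growth[of k] unfolding total .
  qed (rule unit[OF ge(1)] large[OF ge(1)] ge(2))+
qed

section \<open>A continuum of index sets\<close>

text \<open>
  Each element of \<open>S\<close> contributes an infinite column of codes, so that of two distinct sets one
  has codes infinitely many of which are missing from the other.  The element \<open>0\<close> keeps the
  coefficients of a stack bounded by its norm.
\<close>

definition column_code :: "nat set \<Rightarrow> nat set"
  where "column_code S = insert 0 ((\<lambda>x. Suc (prod_encode x)) ` (S \<times> UNIV))"

lemma infinite_column_code_diff: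
  assumes "x \<in> S" "x \<notin> T"
  shows "infinite (column_code S - column_code T)"
proof -
  have "inj (\<lambda>m. Suc (prod_encode (x, m)))"
    by (simp add: inj_def)
  then have "infinite (range (\<lambda>m. Suc (prod_encode (x, m))))"
    by (rule range_inj_infinite)
  moreover have "range (\<lambda>m. Suc (prod_encode (x, m))) \<subseteq> column_code S - column_code T"
    using assms by (auto simp: column_code_def)
  ultimately show ?thesis
    using infinite_super by blast
qed

theorem theorem22:
  fixes e :: "nat \<Rightarrow> 'a::banach"
  assumes "schauder_basis e"
    and "one_subsymmetric e"
    and "\<forall>j. norm (e j) = 1"
    and "\<not> equivalent_seq e l1_unit"
    and "\<forall>n\<ge>1. \<exists>z :: nat \<Rightarrow> 'a.
           (\<forall>i<n. norm (z i) = 1) \<and>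
           (\<forall>i. Suc i < n \<longrightarrow> block_less e (z i) (z (Suc i))) \<and>
           (\<forall>i<n. right_shift e (z i) (z 0)) \<and>
           norm (\<Sum>i<n. z i) \<ge> real n / 2"
  shows "\<exists>\<S> :: (nat \<Rightarrow> 'a) set.
           \<S> \<approx> (UNIV :: nat set set) \<and>
           (\<forall>u\<in>\<S>. subsymmetric u) \<and>
           pairwise (\<lambda>u v. \<not> equivalent_fundamental (fundamental u) (fundamental v)) \<S>"
proof -
  have seq: "one_subsymmetric_sequence e"
    by (rule one_subsymmetric_sequence.intro) (use assms(2,3) in auto)
  have profiles: "\<forall>n\<ge>2. \<exists>L b. norm (\<Sum>l<L. b l *\<^sub>R e l) = 1 \<and>
      norm (\<Sum>i<n. \<Sum>l<L. b l *\<^sub>R e (i * L + l)) \<ge> real n / 2"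
  proof (intro allI impI)
    fix n :: nat
    assume n: "n \<ge> 2"
    then have "n \<ge> 1"
      by simp
    then obtain z where z: "\<forall>i<n. norm (z i) = 1" "\<forall>i. Suc i < n \<longrightarrow> block_less e (z i) (z (Suc i))"
      "\<forall>i<n. right_shift e (z i) (z 0)" "norm (\<Sum>i<n. z i) \<ge> real n / 2"
      using assms(5) by blast
    show "\<exists>L b. norm (\<Sum>l<L. b l *\<^sub>R e l) = 1 \<and>
        norm (\<Sum>i<n. \<Sum>l<L. b l *\<^sub>R e (i * L + l)) \<ge> real n / 2"
      by (rule finite_profile_of_right_shifts[OF assms(1-3) n z])
  qed
  from exists_block_sequence[OF seq assms(4) profiles] obtain N L b where params:
    "\<forall>k. norm (\<Sum>l<L k. b k l *\<^sub>R e l) = 1 \<and>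
      norm (\<Sum>i<N k. \<Sum>l<L k. b k l *\<^sub>R e (i * L k + l)) \<ge> real (N k) / 2 \<and>
      N k \<ge> 4 * k \<and> N k > 0 \<and>
      real (\<Sum>j<k. L j) * fundamental e (N k) \<le> weight k / real (Suc k) * real (N k)"
    by (elim exE) (rule that)
  have blocks: "norm (\<Sum>l<L k. b k l *\<^sub>R e l) = 1"
    and large: "norm (\<Sum>i<N k. \<Sum>l<L k. b k l *\<^sub>R e (i * L k + l)) \<ge> real (N k) / 2"
    and N: "N k \<ge> 4 * k" "N k > 0"
    and growth: "real (\<Sum>j<k. L j) * fundamental e (N k) \<le> weight k / real (Suc k) * real (N k)" for k
    using spec[OF params, of k] by simp_all
  interpret stacked_blocks e L b
    by (rule stacked_blocks.intro[OF seq], rule stacked_blocks_axioms.intro, rule blocks)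
  define u where "u S = stack (column_code S)" for S
  have not_dominated: "\<exists>n. fundamental (u S) n > K * fundamental (u T) n" if "x \<in> S" "x \<notin> T" for S T x K
    unfolding u_def
    by (rule fundamental_stack_not_dominated[OF large N growth[folded offset_def]
          infinite_column_code_diff[OF that]])
  have not_equivalent: "\<not> equivalent_fundamental (fundamental (u S)) (fundamental (u T))"
    if "S \<noteq> T" for S T
  proof
    assume "equivalent_fundamental (fundamental (u S)) (fundamental (u T))"
    then obtain K where K: "K > 0" "\<And>n. inverse K * fundamental (u S) n \<le> fundamental (u T) n"
      "\<And>n. fundamental (u T) n \<le> K * fundamental (u S) n"
      unfolding equivalent_fundamental_def by blast
    have K': "fundamental (u S) n \<le> K * fundamental (u T) n" for n
      using K(2)[of n] K(1) by (simp add: field_simps)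
    from that consider x where "x \<in> S" "x \<notin> T" | x where "x \<in> T" "x \<notin> S" by blast
    then show False
    proof cases
      case 1
      then show False using not_dominated[of x S T K] K' by (meson not_less)
    next
      case 2
      then show False using not_dominated[of x T S K] K(3) by (meson not_less)
    qed
  qed
  have "inj u"
  proof (rule injI)
    fix S T
    assume "u S = u T"
    moreover have "equivalent_fundamental \<phi> \<phi>" for \<phi>
      unfolding equivalent_fundamental_def by (intro exI[of _ 1]) simp
    ultimately show "S = T"
      using not_equivalent[of S T] by auto
  qed
  then have "range u \<approx> (UNIV :: nat set set)"
    by (rule inj_on_image_eqpoll_self)
  moreover have "\<forall>v\<in>range u. subsymmetric v"
    by (auto simp: u_def column_code_def intro!: subsymmetric_stack)
  moreover have "pairwise (\<lambda>u v. \<not> equivalent_fundamental (fundamental u) (fundamental v)) (range u)"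
  proof (rule pairwiseI)
    fix v w
    assume "v \<in> range u" "w \<in> range u" "v \<noteq> w"
    then obtain S T where "v = u S" "w = u T" "S \<noteq> T"
      by auto
    then show "\<not> equivalent_fundamental (fundamental v) (fundamental w)"
      using not_equivalent by simp
  qed
  ultimately show ?thesis
    by (intro exI[of _ "range u"] conjI)
qed

end
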